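(* Let $n\ge 2$ and let $\phi:M_2(\mathbb{C})\to M_{n+1}(\mathbb{C})$ be a positive unital linear map whose Choi matrix has the form $$\left[\begin{array}{cc|cc}1&0&0&Y\\ 0&B&Z^*&T\\ \hline 0&Z&0&0\\ Y^*&T^*&0&U\end{array}\right],$$ where $B,U,T\in M_n(\mathbb{C})$, $Y,Z\in M_{1,n}(\mathbb{C})$, $B,U\ge 0$, and suppose that $|Y|+|Z|=U^{1/2}$. Then: (1) there are vectors $\xi\in\mathbb{C}^2$ and $\eta_0\in\mathbb{C}^{n+1}$ such that $$\phi\in\bigcap_{\eta\perp\eta_0}F_{\xi,\eta};$$ (2) $\phi$ is unitarily equivalent to a map with Choi matrix of the form $$\left[\begin{array}{ccc|ccc} 1&0&0&0&0&y\\ 0&1&0&0&0&W^*\\ 0&0&1-u&\overline{z}&V&t\\ \hline 0&0&z&0&0&0\\ 0&0&V^*&0&0&0\\ \overline{y}&W&\overline{t}&0&0&u \end{array}\right],$$ where in each of the four $(n+1)\times(n+1)$ blocks the entries in positions $[1,1],[1,3],[3,1],[3,3]$ are numbers, those in positions $[1,2],[3,2]$ are one-row matrices from $M_{1,n-1}(\mathbb{C})$, those in positions $[2,1],[2,3]$ are one-column matrices from $M_{n-1,1}(\mathbb{C})$, and those in position $[2,2]$ are square matrices from $M_{n-1}(\mathbb{C})$ (so $y,z,t\in\mathbb{C}$ and $V,W\in M_{1,n-1}(\mathbb{C})$), and where $u=(|y|+|z|)^2$. Moreover, the coefficients satisfy the inequality $$|\langle\rho,Y_1^*\rangle|+|\langle\rho,Z_1^*\rangle|\le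 u^{1/2}$$ for every unit vector $\rho\in\mathbb{C}^n$, where $Y_1,Z_1\in M_{1,n}(\mathbb{C})$ are defined by $$Y_1=\left[\begin{array}{cc}\overline{y}&W\end{array}\right],\qquad Z_1=\left[\begin{array}{cc}\overline{z}&V\end{array}\right].$$
   Context: A linear map $\phi:M_m(\mathbb{C})\to M_k(\mathbb{C})$ is positive if it maps positive (semidefinite) matrices to positive (semidefinite) matrices, and unital if it maps the identity to the identity. $\mathcal{P}(m,k)$ denotes the set of all positive maps $M_m(\mathbb{C})\to M_k(\mathbb{C})$. With $\{E_{ij}\}_{i,j=1}^2$ the standard matrix units of $M_2(\mathbb{C})$, the Choi matrix of a linear map $\phi:M_2(\mathbb{C})\to M_{n+1}(\mathbb{C})$ is the block matrix $[\phi(E_{ij})]_{i,j=1}^2\in M_2(M_{n+1}(\mathbb{C}))$. In the displayed Choi matrices the lines separate the four blocks $\phi(E_{11}),\phi(E_{12}),\phi(E_{21}),\phi(E_{22})$; in the first display each $(n+1)\times(n+1)$ block is itself partitioned according to $n+1=1+n$, and in the second display according to $n+1=1+(n-1)+1$. The symbols $0$ (and the symbol $1$ in position $[2,2]$) stand for zero (resp. identity) matrices of the appropriate size. For $X\in M_{1,n}(\mathbb{C})$, $|X|=(X^*X)^{1/2}\in M_n(\mathbb{C})$. Elements of $M_{n,1}(\mathbb{C})$ are identified with vectors in $\mathbb{C}^n$, and $\langle\cdot,\cdot\rangle$ is the usual scalar product, linear in the second argument. For a nonzero vector $\xi\in\mathbb{C}^2$ and a vector $\eta\in\mathbb{C}^{n+1}$,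 $F_{\xi,\eta}=\{\phi\in\mathcal{P}(2,n+1):\ \phi(P_\xi)\eta=0\}$, where $P_\xi\in M_2(\mathbb{C})$ is the orthogonal projection onto the one-dimensional subspace spanned by $\xi$. Two maps $\phi,\phi':M_2(\mathbb{C})\to M_{n+1}(\mathbb{C})$ are unitarily equivalent if there is a unitary $S\in M_{n+1}(\mathbb{C})$ with $\phi'(A)=S^*\phi(A)S$ for all $A\in M_2(\mathbb{C})$. *)

theory Defs
  imports "Jordan_Normal_Form.Schur_Decomposition"
begin

text \<open>The library product \<open>x \<bullet>c y\<close> is linear in its first argument; the scalar product below
  is linear in its second one.\<close>

definition cinner :: "complex vec \<Rightarrow> complex vec \<Rightarrow> complex" where
  "cinner x y = y \<bullet>c x"

definition positive_mat :: "nat \<Rightarrow> complex mat \<Rightarrow> bool" where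
  "positive_mat n A \<longleftrightarrow> A \<in> carrier_mat n n \<and> mat_adjoint A = A \<and>
     (\<forall>v \<in> carrier_vec n. 0 \<le> Re (cinner v (A *\<^sub>v v)))"

definition unitary_mat :: "nat \<Rightarrow> complex mat \<Rightarrow> bool" where
  "unitary_mat n S \<longleftrightarrow> S \<in> carrier_mat n n \<and>
     mat_adjoint S * S = 1\<^sub>m n \<and> S * mat_adjoint S = 1\<^sub>m n"

text \<open>Meaningful for positive matrices only, whose positive square root is unique.\<close>

definition sqrt_mat :: "complex mat \<Rightarrow> complex mat" where
  "sqrt_mat A = (THE R. positive_mat (dim_row A) R \<and> R * R = A)"

definition abs_mat :: "complex mat \<Rightarrow> complex mat" where
  "abs_mat X = sqrt_mat (mat_adjoint X * X)"

text \<open>A map between matrix algebras is a function on the type of matrices of all sizes; only its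
  values on matrices of the stated size matter.\<close>

definition linear_mat_map :: "nat \<Rightarrow> nat \<Rightarrow> (complex mat \<Rightarrow> complex mat) \<Rightarrow> bool" where
  "linear_mat_map m k \<phi> \<longleftrightarrow>
     (\<forall>A \<in> carrier_mat m m. \<phi> A \<in> carrier_mat k k) \<and>
     (\<forall>A \<in> carrier_mat m m. \<forall>B \<in> carrier_mat m m. \<phi> (A + B) = \<phi> A + \<phi> B) \<and>
     (\<forall>c. \<forall>A \<in> carrier_mat m m. \<phi> (c \<cdot>\<^sub>m A) = c \<cdot>\<^sub>m \<phi> A)"

definition positive_maps :: "nat \<Rightarrow> nat \<Rightarrow> (complex mat \<Rightarrow> complex mat) set" where
  "positive_maps m k =
     {\<phi>. linear_mat_map m k \<phi> \<and> (\<forall>A. positive_mat m A \<longrightarrow> positive_mat k (\<phi> A))}"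

definition unital_map :: "nat \<Rightarrow> nat \<Rightarrow> (complex mat \<Rightarrow> complex mat) \<Rightarrow> bool" where
  "unital_map m k \<phi> \<longleftrightarrow> \<phi> (1\<^sub>m m) = 1\<^sub>m k"

definition unitarily_equivalent ::
  "nat \<Rightarrow> nat \<Rightarrow> (complex mat \<Rightarrow> complex mat) \<Rightarrow> (complex mat \<Rightarrow> complex mat) \<Rightarrow> bool" where
  "unitarily_equivalent m k \<phi> \<phi>' \<longleftrightarrow>
     (\<exists>S. unitary_mat k S \<and> (\<forall>A \<in> carrier_mat m m. \<phi>' A = mat_adjoint S * \<phi> A * S))"

text \<open>Indices start at \<open>0\<close>: the matrix unit \<open>E\<^sub>1\<^sub>1\<close> is \<open>unit_mat2 0 0\<close>, and so on.\<close>

definition unit_mat2 :: "nat \<Rightarrow> nat \<Rightarrow> complex mat" where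
  "unit_mat2 i j = mat 2 2 (\<lambda>(a, b). if a = i \<and> b = j then 1 else 0)"

definition choi_mat :: "(complex mat \<Rightarrow> complex mat) \<Rightarrow> complex mat" where
  "choi_mat \<phi> = four_block_mat (\<phi> (unit_mat2 0 0)) (\<phi> (unit_mat2 0 1))
                               (\<phi> (unit_mat2 1 0)) (\<phi> (unit_mat2 1 1))"

text \<open>For \<open>\<xi> \<noteq> 0\<close>, the orthogonal projection \<open>v \<mapsto> (\<langle>\<xi>,v\<rangle> / \<langle>\<xi>,\<xi>\<rangle>) \<xi>\<close> onto the line spanned
  by \<open>\<xi>\<close>.\<close>

definition proj_mat :: "complex vec \<Rightarrow> complex mat" where
  "proj_mat \<xi> = mat (dim_vec \<xi>) (dim_vec \<xi>) (\<lambda>(i, j). \<xi> $ i * cnj (\<xi> $ j) / cinner \<xi> \<xi>)"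

lemma proj_mat_mult_vec:
  assumes "\<xi> \<in> carrier_vec m" "v \<in> carrier_vec m"
  shows "proj_mat \<xi> *\<^sub>v v = (cinner \<xi> v / cinner \<xi> \<xi>) \<cdot>\<^sub>v \<xi>"
  using assms
  by (intro eq_vecI) (auto simp: proj_mat_def scalar_prod_def sum_distrib_left sum_divide_distrib
      cinner_def[of \<xi> v] mult_ac intro!: sum.cong)

lemma proj_mat_orthogonal:
  assumes "\<xi> \<in> carrier_vec m" "\<xi> \<noteq> 0\<^sub>v m" "v \<in> carrier_vec m"
  shows "cinner \<xi> (v - proj_mat \<xi> *\<^sub>v v) = 0"
proof -
  have "cinner \<xi> \<xi> \<noteq> 0"
    using assms by (simp add: cinner_def conjugate_square_eq_0_vec)
  moreover have "cinner \<xi> (v - proj_mat \<xi> *\<^sub>v v) =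
      cinner \<xi> v - (cinner \<xi> v / cinner \<xi> \<xi>) * cinner \<xi> \<xi>"
    unfolding proj_mat_mult_vec[OF assms(1,3)] unfolding cinner_def
    using assms by (subst minus_scalar_prod_distrib[of _ m]) auto
  ultimately show ?thesis by simp
qed

definition face :: "nat \<Rightarrow> complex vec \<Rightarrow> complex vec \<Rightarrow> (complex mat \<Rightarrow> complex mat) set" where
  "face k \<xi> \<eta> = {\<phi> \<in> positive_maps 2 k. \<phi> (proj_mat \<xi>) *\<^sub>v \<eta> = 0\<^sub>v k}"

text \<open>Horizontal concatenation, the counterpart of the library's \<open>@\<^sub>r\<close>.\<close>

definition append_cols :: "'a :: zero mat \<Rightarrow> 'a mat \<Rightarrow> 'a mat" (infixr \<open>@\<^sub>c\<close> 70) where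
  "A @\<^sub>c B = four_block_mat A B (0\<^sub>m 0 (dim_col A)) (0\<^sub>m 0 (dim_col B))"

definition scalar_mat :: "'a \<Rightarrow> 'a mat" where
  "scalar_mat c = mat 1 1 (\<lambda>_. c)"

lemma append_cols_carrier [simp, intro]:
  "A \<in> carrier_mat r c \<Longrightarrow> B \<in> carrier_mat r d \<Longrightarrow> A @\<^sub>c B \<in> carrier_mat r (c + d)"
  by (auto simp: append_cols_def)

lemma append_cols_index:
  assumes "A \<in> carrier_mat r c" "B \<in> carrier_mat r d" "i < r" "j < c + d"
  shows "(A @\<^sub>c B) $$ (i, j) = (if j < c then A $$ (i, j) else B $$ (i, j - c))"
  using assms by (auto simp: append_cols_def)

end

theory Submission
  imports Defs "Jordan_Normal_Form.Spectral_Radius"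
begin

text \<open>If \<open>\<phi>(E\<^sub>2\<^sub>2) x = 0\<close>, then evaluating \<open>\<phi>\<close> on the rank one matrices of the vectors \<open>(a, 1)\<close>, at
  \<open>c x + y\<close> with \<open>a \<rightarrow> 0\<close> and \<open>\<bar>a c\<bar>\<close> fixed, gives
  \<open>(\<bar>\<langle>x, \<phi>(E\<^sub>1\<^sub>2) y\<rangle>\<bar> + \<bar>\<langle>y, \<phi>(E\<^sub>1\<^sub>2) x\<rangle>\<bar>)\<^sup>2 \<le> \<langle>x, \<phi>(E\<^sub>1\<^sub>1) x\<rangle> \<langle>y, \<phi>(E\<^sub>2\<^sub>2) y\<rangle>\<close>,
  and that \<open>\<phi>(E\<^sub>1\<^sub>2)\<close> vanishes as a form on the kernel of \<open>\<phi>(E\<^sub>2\<^sub>2)\<close>. With \<open>x\<close> the first basis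
  vector this reads \<open>(\<bar>Y v\<bar> + \<bar>Z v\<bar>)\<^sup>2 \<le> \<langle>v, U v\<rangle>\<close>; as \<open>U = (|Y| + |Z|)\<^sup>2\<close>, it forces \<open>Y\<^sup>*\<close> and
  \<open>Z\<^sup>*\<close> to be multiples of one unit vector \<open>e\<close>, so \<open>U\<close> has rank at most one. A unitary that fixes
  the first basis vector and sends the last one to a multiple of \<open>(0, e)\<close> brings \<open>\<phi>\<close> to the normal form,
  and a second use of the inequality, with \<open>x\<close> orthogonal to the last basis vector \<open>y\<close>, gives the
  estimate on the coefficients.\<close>

section \<open>Scalar products and adjoints\<close>

lemma cinner_sum: "cinner x y = (\<Sum>i<dim_vec x. cnj (x $ i) * y $ i)"
  by (auto simp: cinner_def scalar_prod_def atLeast0LessThan mult.commute intro!: sum.cong)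

lemma cinner_cnj: "dim_vec x = dim_vec y \<Longrightarrow> cnj (cinner x y) = cinner y x"
  by (simp add: cinner_sum mult.commute)

lemma cinner_add_left: "dim_vec x = dim_vec y \<Longrightarrow> cinner (x + y) z = cinner x z + cinner y z"
  by (simp add: cinner_sum sum.distrib algebra_simps)

lemma cinner_add_right:
  "dim_vec y = dim_vec x \<Longrightarrow> dim_vec z = dim_vec x \<Longrightarrow> cinner x (y + z) = cinner x y + cinner x z"
  by (simp add: cinner_sum sum.distrib algebra_simps)

lemma cinner_minus_left: "dim_vec x = dim_vec y \<Longrightarrow> cinner (x - y) z = cinner x z - cinner y z"
  by (simp add: cinner_sum sum_subtractf algebra_simps)

lemma cinner_minus_right:
  "dim_vec y = dim_vec x \<Longrightarrow> dim_vec z = dim_vec x \<Longrightarrow> cinner x (y - z) = cinner x y - cinner x z"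
  by (simp add: cinner_sum sum_subtractf algebra_simps)

lemma cinner_smult_left: "cinner (c \<cdot>\<^sub>v x) z = cnj c * cinner x z"
  by (simp add: cinner_sum sum_distrib_left algebra_simps)

lemma cinner_smult_right: "dim_vec y = dim_vec x \<Longrightarrow> cinner x (c \<cdot>\<^sub>v y) = c * cinner x y"
  by (simp add: cinner_sum sum_distrib_left algebra_simps)

lemma cinner_zero_right: "cinner x (0\<^sub>v (dim_vec x)) = 0"
  by (simp add: cinner_sum)

lemma cinner_zero_left: "cinner (0\<^sub>v n) x = 0"
  by (simp add: cinner_sum)

lemma cinner_unit_left: "i < n \<Longrightarrow> cinner (unit_vec n i) v = v $ i"
proof -
  assume i: "i < n"
  have "cinner (unit_vec n i) v = (\<Sum>j<n. if j = i then v $ j else 0)"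
    unfolding cinner_sum using i by (intro sum.cong) auto
  then show ?thesis using i by (simp add: sum.delta)
qed

lemma cinner_unit_right: "i < n \<Longrightarrow> dim_vec v = n \<Longrightarrow> cinner v (unit_vec n i) = cnj (v $ i)"
  by (metis cinner_unit_left cinner_cnj index_unit_vec(3))

lemma cinner_self: "cinner x x = complex_of_real (\<Sum>i<dim_vec x. (cmod (x $ i))\<^sup>2)"
  unfolding cinner_sum of_real_sum complex_norm_square by (simp add: mult.commute)

lemma cinner_self_Re: "cinner x x = complex_of_real (Re (cinner x x))"
  by (simp add: cinner_self)

lemma cinner_self_nonneg: "Re (cinner x x) \<ge> 0"
  by (simp add: cinner_self sum_nonneg)

lemma cinner_self_eq_0: "cinner x x = 0 \<longleftrightarrow> x = 0\<^sub>v (dim_vec x)"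
  unfolding cinner_def by (rule conjugate_square_eq_0_vec) auto

lemma cinner_self_Re_eq_0: "Re (cinner x x) = 0 \<longleftrightarrow> x = 0\<^sub>v (dim_vec x)"
proof -
  have "Re (cinner x x) = 0 \<longleftrightarrow> cinner x x = 0"
    unfolding cinner_self by (simp only: Re_complex_of_real of_real_eq_0_iff)
  then show ?thesis by (simp only: cinner_self_eq_0)
qed

section \<open>Adjoints and their action on scalar products\<close>

lemma mat_adjoint_dim [simp]: "dim_row (mat_adjoint A) = dim_col A" "dim_col (mat_adjoint A) = dim_row A"
  by (simp_all add: mat_adjoint_def)

lemma mat_adjoint_carrier [simp, intro]: "A \<in> carrier_mat n m \<Longrightarrow> mat_adjoint A \<in> carrier_mat m n"
  by (intro carrier_matI) simp_all

lemma mat_adjoint_index [simp]: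
  "i < dim_col A \<Longrightarrow> j < dim_row A \<Longrightarrow> mat_adjoint (A :: complex mat) $$ (i, j) = cnj (A $$ (j, i))"
  by (simp add: mat_adjoint_def mat_of_rows_index)

lemma mat_adjoint_adjoint [simp]: "mat_adjoint (mat_adjoint (A :: complex mat)) = A"
  by (intro eq_matI) auto

lemma mat_adjoint_mult:
  assumes "A \<in> carrier_mat n m" "B \<in> carrier_mat m k"
  shows "mat_adjoint (A * B :: complex mat) = mat_adjoint B * mat_adjoint A"
proof (rule eq_matI)
  fix i j assume ij: "i < dim_row (mat_adjoint B * mat_adjoint A)" "j < dim_col (mat_adjoint B * mat_adjoint A)"
  then have "mat_adjoint (A * B) $$ (i, j) = (\<Sum>l\<in>{0..<m}. cnj (A $$ (j, l) * B $$ (l, i)))"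
    using assms by (simp add: scalar_prod_def)
  also have "\<dots> = (mat_adjoint B * mat_adjoint A) $$ (i, j)"
    using assms ij by (simp add: scalar_prod_def mult.commute)
  finally show "mat_adjoint (A * B) $$ (i, j) = (mat_adjoint B * mat_adjoint A) $$ (i, j)" .
qed (use assms in auto)

lemma mult_vec_index_sum: "i < dim_row A \<Longrightarrow> dim_vec v = dim_col A \<Longrightarrow>
   (A *\<^sub>v v) $ i = (\<Sum>j<dim_col A. A $$ (i, j) * v $ j)"
  by (auto simp: scalar_prod_def atLeast0LessThan intro!: sum.cong)

lemma cinner_mult_right:
  assumes "A \<in> carrier_mat n m" "x \<in> carrier_vec n" "y \<in> carrier_vec m"
  shows "cinner x (A *\<^sub>v y) = cinner (mat_adjoint A *\<^sub>v x) y"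
proof -
  have "cinner x (A *\<^sub>v y) = (\<Sum>i<n. \<Sum>j<m. cnj (x $ i) * (A $$ (i, j) * y $ j))"
    using assms by (simp add: cinner_sum mult_vec_index_sum sum_distrib_left del: index_mult_mat_vec)
  also have "\<dots> = (\<Sum>j<m. \<Sum>i<n. cnj (x $ i) * (A $$ (i, j) * y $ j))"
    by (rule sum.swap)
  also have "\<dots> = cinner (mat_adjoint A *\<^sub>v x) y"
    using assms by (simp add: cinner_sum mult_vec_index_sum sum_distrib_right sum_distrib_left mult_ac del: index_mult_mat_vec)
  finally show ?thesis .
qed

lemma cinner_mult_left:
  assumes "A \<in> carrier_mat n m" "x \<in> carrier_vec n" "y \<in> carrier_vec m"
  shows "cinner (A *\<^sub>v y) x = cinner y (mat_adjoint A *\<^sub>v x)"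
  using cinner_mult_right[of "mat_adjoint A" m n y x] assms by simp

lemma cinner_unit_mat:
  assumes "A \<in> carrier_mat n n" "i < n" "j < n"
  shows "cinner (unit_vec n i) (A *\<^sub>v unit_vec n j) = A $$ (i, j)"
  using assms by (simp add: cinner_unit_left)

lemma mat_eq_by_vec:
  assumes "A \<in> carrier_mat n n" "B \<in> carrier_mat n n"
    and "\<And>v. v \<in> carrier_vec n \<Longrightarrow> A *\<^sub>v v = B *\<^sub>v (v :: complex vec)"
  shows "A = B"
proof (rule eq_matI)
  fix i j assume "i < dim_row B" "j < dim_col B"
  then show "A $$ (i, j) = B $$ (i, j)"
    using assms cinner_unit_mat[of A n i j] cinner_unit_mat[of B n i j] by simp
qed (use assms in auto)

lemma cinner_expand:
  assumes A: "A \<in> carrier_mat n n" and x: "x \<in> carrier_vec n" and y: "y \<in> carrier_vec n"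
  shows "cinner (c \<cdot>\<^sub>v x + y) (A *\<^sub>v (c \<cdot>\<^sub>v x + y)) =
     of_real ((cmod c)\<^sup>2) * cinner x (A *\<^sub>v x) + cnj c * cinner x (A *\<^sub>v y) + c * cinner y (A *\<^sub>v x)
       + cinner y (A *\<^sub>v y)"
proof -
  have "A *\<^sub>v (c \<cdot>\<^sub>v x + y) = c \<cdot>\<^sub>v (A *\<^sub>v x) + A *\<^sub>v y"
    using assms by (simp add: mult_add_distrib_mat_vec[OF A] mult_mat_vec[OF A])
  then show ?thesis
    using assms
    by (simp add: cinner_add_left cinner_add_right cinner_smult_left cinner_smult_right
        of_real_power[symmetric] complex_norm_square algebra_simps del: of_real_power)
qed

section \<open>Positive matrices: kernels and conjugation\<close>

lemma positive_matD:
  assumes "positive_mat n A"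
  shows "A \<in> carrier_mat n n" "mat_adjoint A = A"
    "\<And>v. v \<in> carrier_vec n \<Longrightarrow> 0 \<le> Re (cinner v (A *\<^sub>v v))"
  using assms by (auto simp: positive_mat_def)

lemma hermitian_cinner_swap:
  assumes "A \<in> carrier_mat n n" "mat_adjoint A = A" "x \<in> carrier_vec n" "y \<in> carrier_vec n"
  shows "cinner y (A *\<^sub>v x) = cnj (cinner x (A *\<^sub>v y))"
  using assms cinner_mult_right[of A n n y x] cinner_cnj[of x "A *\<^sub>v y"] by simp

text \<open>With \<open>y = A x\<close> the form at \<open>c x + y\<close> is
  \<open>2 c N + K\<close> for real \<open>c\<close>, where \<open>N\<close> is the squared norm of
  \<open>A x\<close>. An affine function of \<open>c\<close> that stays nonnegative has slope
  \<open>0\<close>.\<close>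

lemma positive_mat_kernel:
  assumes A: "positive_mat n A" and x: "x \<in> carrier_vec n" and 0: "Re (cinner x (A *\<^sub>v x)) = 0"
  shows "A *\<^sub>v x = 0\<^sub>v n"
proof -
  note AD = positive_matD[OF A]
  define y where "y = A *\<^sub>v x"
  have y: "y \<in> carrier_vec n" using AD(1) x by (simp add: y_def)
  define N where "N = Re (cinner y y)"
  define K where "K = Re (cinner y (A *\<^sub>v y))"
  have N: "cinner y (A *\<^sub>v x) = of_real N" "cinner x (A *\<^sub>v y) = of_real N"
    using cinner_self_Re[of y] hermitian_cinner_swap[OF AD(1,2) y x] cinner_cnj[of y y]
    by (simp_all add: N_def y_def[symmetric])
  have K: "K \<ge> 0" using AD(3)[OF y] by (simp add: K_def)
  have ineq: "0 \<le> 2 * c * N + K" for c :: real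
    using AD(3)[of "of_real c \<cdot>\<^sub>v x + y"] x y cinner_expand[OF AD(1) x y, of "of_real c"] 0 N
    by (simp add: K_def algebra_simps)
  have "N = 0"
  proof (rule ccontr)
    assume "N \<noteq> 0"
    then have "2 * (- (K + 1) / (2 * N)) * N + K = -1" by (simp add: field_simps)
    then show False using ineq[of "- (K + 1) / (2 * N)"] by linarith
  qed
  then have "y = 0\<^sub>v (dim_vec y)" unfolding N_def cinner_self_Re_eq_0 .
  then show ?thesis using AD(1) by (simp add: y_def)
qed

lemma cinner_conj:
  assumes A: "A \<in> carrier_mat n n" and S: "S \<in> carrier_mat n m" and x: "x \<in> carrier_vec m"
    and y: "y \<in> carrier_vec m"
  shows "cinner x ((mat_adjoint S * A * S) *\<^sub>v y) = cinner (S *\<^sub>v x) (A *\<^sub>v (S *\<^sub>v y))"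
proof -
  have "(mat_adjoint S * A * S) *\<^sub>v y = (mat_adjoint S * A) *\<^sub>v (S *\<^sub>v y)"
    by (rule assoc_mult_mat_vec) (use A S y in auto)
  also have "\<dots> = mat_adjoint S *\<^sub>v (A *\<^sub>v (S *\<^sub>v y))"
    by (rule assoc_mult_mat_vec) (use A S y in auto)
  finally show ?thesis
    using A S x y cinner_mult_left[of S n m "A *\<^sub>v (S *\<^sub>v y)" x] by simp
qed

lemma mat_adjoint_conj:
  fixes A S :: "complex mat"
  assumes A: "A \<in> carrier_mat n n" and S: "S \<in> carrier_mat n m"
  shows "mat_adjoint (mat_adjoint S * A * S) = mat_adjoint S * mat_adjoint A * S"
proof -
  have "mat_adjoint (mat_adjoint S * A * S) = mat_adjoint S * mat_adjoint (mat_adjoint S * A)"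
    by (rule mat_adjoint_mult) (use A S in auto)
  also have "mat_adjoint (mat_adjoint S * A) = mat_adjoint A * S"
    using A S mat_adjoint_mult[of "mat_adjoint S" m n A n] by simp
  also have "mat_adjoint S * (mat_adjoint A * S) = mat_adjoint S * mat_adjoint A * S"
    by (rule assoc_mult_mat[symmetric]) (use A S in auto)
  finally show ?thesis .
qed

lemma positive_mat_conj:
  assumes A: "positive_mat n A" and S: "S \<in> carrier_mat n m"
  shows "positive_mat m (mat_adjoint S * A * S)"
  unfolding positive_mat_def
proof (intro conjI ballI)
  note AD = positive_matD[OF A]
  show "mat_adjoint S * A * S \<in> carrier_mat m m" using AD(1) S by auto
  show "mat_adjoint (mat_adjoint S * A * S) = mat_adjoint S * A * S"
    using AD(1,2) S mat_adjoint_conj by metis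
  fix v :: "complex vec" assume v: "v \<in> carrier_vec m"
  show "0 \<le> Re (cinner v ((mat_adjoint S * A * S) *\<^sub>v v))"
    using AD(3)[of "S *\<^sub>v v"] S v cinner_conj[OF AD(1) S v v] by simp
qed

section \<open>Phases and real quadratic inequalities\<close>

lemma phase_ex:
  fixes p :: complex
  obtains w where "cmod w = 1" "w * p = of_real (cmod p)"
proof (cases "p = 0")
  case True
  then show ?thesis using that[of 1] by simp
next
  case False
  have "cmod (cnj p / of_real (cmod p)) = 1" using False by (simp add: norm_divide)
  moreover have "cnj p / of_real (cmod p) * p = of_real (cmod p)"
    using False complex_norm_square[of p] by (simp add: field_simps power2_eq_square)
  ultimately show ?thesis using that by blast
qed

text \<open>If \<open>a\<close> and \<open>b\<close> are phases that make \<open>a p\<close> and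
  \<open>b q\<close> nonnegative, it remains to solve \<open>w * cnj g = - a\<close> and
  \<open>w * g = - b\<close>. A square root \<open>w\<close> of \<open>a b\<close> together with
  \<open>g = - b * cnj w\<close> does this.\<close>

lemma two_phases_ex:
  fixes p q :: complex
  obtains w g where "cmod w = 1" "cmod g = 1" "w * cnj g * p = - of_real (cmod p)"
    "w * g * q = - of_real (cmod q)"
proof -
  obtain a where a: "cmod a = 1" "a * p = of_real (cmod p)" by (rule phase_ex)
  obtain b where b: "cmod b = 1" "b * q = of_real (cmod q)" by (rule phase_ex)
  define w where "w = csqrt (a * b)"
  have w2: "w * w = a * b" by (simp add: w_def power2_eq_square[symmetric])
  then have "cmod w * cmod w = 1" using a b by (metis norm_mult mult_1)
  then have w1: "cmod w = 1"
    by (metis abs_norm_cancel norm_ge_zero power2_eq_square real_sqrt_abs real_sqrt_one)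
  have wc: "w * cnj w = 1" using w1 by (simp flip: complex_norm_square)
  have bc: "b * cnj b = 1" using b(1) by (simp flip: complex_norm_square)
  define g where "g = - b * cnj w"
  show ?thesis
  proof (rule that[of w g])
    show "cmod w = 1" "cmod g = 1" using w1 b(1) by (simp_all add: g_def norm_mult)
    have "w * cnj g * p = - (w * w) * cnj b * p" by (simp add: g_def)
    also have "\<dots> = - (b * cnj b) * (a * p)" by (simp add: w2)
    finally show "w * cnj g * p = - of_real (cmod p)" using a(2) bc by simp
    have "w * g * q = - (w * cnj w) * (b * q)" by (simp add: g_def)
    then show "w * g * q = - of_real (cmod q)" using b(2) wc by simp
  qed
qed

lemma limit_nonneg:
  fixes A B C :: real
  assumes "\<And>s. s > 0 \<Longrightarrow> 0 \<le> A + B * s + C * s\<^sup>2"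
  shows "0 \<le> A"
proof (rule tendsto_lowerbound)
  show "((\<lambda>s. A + B * s + C * s\<^sup>2) \<longlongrightarrow> A) (at_right 0)"
    by (auto intro!: tendsto_eq_intros)
  show "\<forall>\<^sub>F s in at_right 0. 0 \<le> A + B * s + C * s\<^sup>2"
    using assms by (auto simp: eventually_at_filter)
qed simp

lemma quadratic_nonneg_discriminant:
  fixes Q P R :: real
  assumes "\<And>r. r \<ge> 0 \<Longrightarrow> 0 \<le> Q * r\<^sup>2 - 2 * r * P + R" and P: "P \<ge> 0"
  shows "P\<^sup>2 \<le> Q * R"
proof -
  have Q: "0 \<le> Q"
  \<comment> \<open>Putting \<open>r = 1 / s\<close> and multiplying by \<open>s\<^sup>2\<close>
    exchanges the leading and the constant coefficient.\<close>
  proof (rule limit_nonneg[of _ "- 2 * P" R])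
    fix s :: real assume s: "s > 0"
    have "0 \<le> (Q * (1 / s)\<^sup>2 - 2 * (1 / s) * P + R) * s\<^sup>2"
      using assms(1)[of "1 / s"] s by (intro mult_nonneg_nonneg) auto
    also have "\<dots> = Q + (- 2 * P) * s + R * s\<^sup>2"
      using s by (simp add: field_simps power2_eq_square)
    finally show "0 \<le> Q + (- 2 * P) * s + R * s\<^sup>2" .
  qed
  show ?thesis
  proof (cases "Q = 0")
    case True
    have "P = 0"
    proof (rule ccontr)
      assume "P \<noteq> 0"
      then have "P > 0" using P by simp
      have "R \<ge> 0" using assms(1)[of 0] by simp
      \<comment> \<open>Without the quadratic term, the value at \<open>r = (R + 1) / P\<close> is
        \<open>- R - 2\<close>, which is negative.\<close>
      then have "0 \<le> - (2 * ((R + 1) / P) * P) + R"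
        using assms(1)[of "(R + 1) / P"] \<open>P > 0\<close> True by simp
      then show False using \<open>P > 0\<close> \<open>R \<ge> 0\<close> by simp
    qed
    then show ?thesis using True by simp
  next
    case False
    then have "Q > 0" using Q by simp
    have "0 \<le> (Q * (P / Q)\<^sup>2 - 2 * (P / Q) * P + R) * Q"
      using assms(1)[of "P / Q"] P \<open>Q > 0\<close> by (intro mult_nonneg_nonneg) auto
    also have "\<dots> = Q * R - P\<^sup>2" using \<open>Q > 0\<close> by (simp add: field_simps power2_eq_square)
    finally show ?thesis by simp
  qed
qed

text \<open>The scalar core of the inequality for positive maps: \<open>p\<close>, \<open>q\<close>,
  \<open>k\<close> will be the values of the form of \<phi>(E12) at \<open>(x, y)\<close>,
  \<open>(y, x)\<close>, \<open>(y, y)\<close>, while \<open>Q\<close>, \<open>K1\<close>,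
  \<open>K2\<close>, \<open>K3\<close> come from \<phi>(E11) and \<open>R\<close> from
  \<phi>(E22).\<close>

lemma pencil_inequality:
  fixes p q k K1 K2 :: complex and Q K3 R :: real
  assumes ineq: "\<And>a c. 0 \<le> (cmod a)\<^sup>2 * ((cmod c)\<^sup>2 * Q + Re (cnj c * K1 + c * K2) + K3)
      + 2 * Re (a * (cnj c * p + c * q + k)) + R"
  shows "(cmod p + cmod q)\<^sup>2 \<le> Q * R"
proof (rule quadratic_nonneg_discriminant)
  fix r :: real assume "r \<ge> 0"
  obtain w g where w: "cmod w = 1" "cmod g = 1" "w * cnj g * p = - of_real (cmod p)"
    "w * g * q = - of_real (cmod q)" by (rule two_phases_ex)
  define B where "B = r * Re (cnj g * K1 + g * K2) + 2 * Re (w * k)"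
  show "0 \<le> Q * r\<^sup>2 - 2 * r * (cmod p + cmod q) + R"
  proof (rule limit_nonneg[of _ B K3])
    fix s :: real assume s: "s > 0"
    \<comment> \<open>The product \<open>a c\<close> keeps the modulus \<open>r\<close> while
      \<open>a\<close> tends to \<open>0\<close>, so the terms with \<open>K1\<close>,
      \<open>K2\<close>, \<open>K3\<close> and \<open>k\<close> carry a positive power of
      \<open>s\<close> and vanish in the limit.\<close>
    define a where "a = of_real s * w"
    define c where "c = of_real (r / s) * g"
    have ca: "(cmod a)\<^sup>2 = s\<^sup>2" "(cmod c)\<^sup>2 = (r / s)\<^sup>2"
      using w by (simp_all add: a_def c_def norm_mult norm_divide power_mult_distrib power_divide)
    have "a * (cnj c * p + c * q + k)
      = of_real (s * (r / s)) * (w * cnj g * p) + of_real (s * (r / s)) * (w * g * q) + of_real s * (w * k)"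
      by (simp add: a_def c_def algebra_simps)
    also have "\<dots> = of_real (- r * (cmod p + cmod q)) + of_real s * (w * k)"
      using s unfolding w(3,4) by (simp add: algebra_simps)
    finally have 1: "Re (a * (cnj c * p + c * q + k)) = - r * (cmod p + cmod q) + s * Re (w * k)"
      by simp
    have "cnj c * K1 + c * K2 = of_real (r / s) * (cnj g * K1 + g * K2)"
      by (simp add: c_def algebra_simps)
    then have 2: "Re (cnj c * K1 + c * K2) = r / s * Re (cnj g * K1 + g * K2)"
      by (simp del: of_real_divide)
    have "s\<^sup>2 * ((r / s)\<^sup>2 * Q + r / s * Re (cnj g * K1 + g * K2) + K3)
        + 2 * (- r * (cmod p + cmod q) + s * Re (w * k)) + R
      = Q * r\<^sup>2 - 2 * r * (cmod p + cmod q) + R + B * s + K3 * s\<^sup>2"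
      using s unfolding B_def by (simp add: field_simps power2_eq_square del: complex_Re_numeral plus_complex.sel times_complex.sel)
    then show "0 \<le> Q * r\<^sup>2 - 2 * r * (cmod p + cmod q) + R + B * s + K3 * s\<^sup>2"
      using ineq[of a c] unfolding ca 1 2 by simp
  qed
qed simp

section \<open>Positive maps on two by two matrices\<close>

declare One_nat_def [simp del]

lemma smult_mat_mult_vec:
  "dim_vec v = dim_col A \<Longrightarrow> (c \<cdot>\<^sub>m A) *\<^sub>v v = c \<cdot>\<^sub>v (A *\<^sub>v (v :: complex vec))"
  by (intro eq_vecI) (auto simp: scalar_prod_def sum_distrib_left mult_ac)

lemma Re_of_real_mult: "Re (complex_of_real r * z) = r * Re z"
  by simp

abbreviation vec2 :: "complex \<Rightarrow> complex \<Rightarrow> complex vec" where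
  "vec2 a b \<equiv> vec 2 (\<lambda>i. if i = 0 then a else b)"

text \<open>This is \<open>x x^*\<close> without normalisation; for a unit vector it is the
  projection \<open>proj_mat x\<close>.\<close>

definition outer :: "complex vec \<Rightarrow> complex mat" where
  "outer x = mat (dim_vec x) (dim_vec x) (\<lambda>(i, j). x $ i * cnj (x $ j))"

lemma outer_carrier [simp]: "x \<in> carrier_vec n \<Longrightarrow> outer x \<in> carrier_mat n n"
  by (auto simp: outer_def)

lemma outer_mult_vec:
  "dim_vec v = dim_vec x \<Longrightarrow> outer x *\<^sub>v v = cinner x v \<cdot>\<^sub>v x"
  by (intro eq_vecI)
    (auto simp: outer_def cinner_sum scalar_prod_def atLeast0LessThan sum_distrib_left sum_distrib_right
      mult_ac)

lemma positive_outer: "x \<in> carrier_vec n \<Longrightarrow> positive_mat n (outer x)"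
  unfolding positive_mat_def
proof (intro conjI ballI)
  assume x: "x \<in> carrier_vec n"
  show "mat_adjoint (outer x) = outer x"
    by (intro eq_matI) (auto simp: outer_def)
  fix v :: "complex vec" assume v: "v \<in> carrier_vec n"
  have "cinner v (outer x *\<^sub>v v) = cinner x v * cinner v x"
    using x v by (simp add: outer_mult_vec cinner_smult_right)
  also have "\<dots> = of_real ((cmod (cinner x v))\<^sup>2)"
    using x v cinner_cnj[of x v] by (simp add: complex_norm_square del: of_real_power)
  finally show "0 \<le> Re (cinner v (outer x *\<^sub>v v))" by simp
qed simp

section \<open>Matrix units and the values of a positive map on rank one matrices\<close>

lemma unit_mat2_carrier [simp]: "unit_mat2 i j \<in> carrier_mat 2 2"
  by (simp add: unit_mat2_def)

lemma unit_mat2_outer: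
  "unit_mat2 0 0 = outer (vec2 1 0)" "unit_mat2 1 1 = outer (vec2 0 1)"
  by (rule eq_matI; auto simp: unit_mat2_def outer_def less_2_cases_iff)+

text \<open>These rank one matrices serve as test matrices: positivity at all of them becomes a
  condition on a pencil in \<open>a\<close> whose coefficients are the four Choi blocks.\<close>

lemma outer_decomp:
  "outer (vec2 a 1) = of_real ((cmod a)\<^sup>2) \<cdot>\<^sub>m unit_mat2 0 0 + a \<cdot>\<^sub>m unit_mat2 0 1
     + cnj a \<cdot>\<^sub>m unit_mat2 1 0 + unit_mat2 1 1"
  by (rule eq_matI; auto simp: unit_mat2_def outer_def less_2_cases_iff complex_norm_square
      simp del: of_real_power)

lemma positive_mapsD:
  assumes "\<phi> \<in> positive_maps 2 k"
  shows "\<phi> (unit_mat2 i j) \<in> carrier_mat k k"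
    "positive_mat k (\<phi> (unit_mat2 0 0))" "positive_mat k (\<phi> (unit_mat2 1 1))"
    "positive_mat k (\<phi> (outer (vec2 a 1)))"
proof -
  have \<phi>: "\<And>A. A \<in> carrier_mat 2 2 \<Longrightarrow> \<phi> A \<in> carrier_mat k k" "\<And>A. positive_mat 2 A \<Longrightarrow> positive_mat k (\<phi> A)"
    using assms by (auto simp: positive_maps_def linear_mat_map_def)
  show "\<phi> (unit_mat2 i j) \<in> carrier_mat k k" by (rule \<phi>(1)) simp
  show "positive_mat k (\<phi> (unit_mat2 0 0))" "positive_mat k (\<phi> (unit_mat2 1 1))"
    "positive_mat k (\<phi> (outer (vec2 a 1)))"
    unfolding unit_mat2_outer by (rule \<phi>(2), rule positive_outer, simp)+
qed

lemma positive_maps_pencil: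
  assumes "\<phi> \<in> positive_maps 2 k"
  shows "\<phi> (outer (vec2 a 1)) = of_real ((cmod a)\<^sup>2) \<cdot>\<^sub>m \<phi> (unit_mat2 0 0)
     + a \<cdot>\<^sub>m \<phi> (unit_mat2 0 1) + cnj a \<cdot>\<^sub>m \<phi> (unit_mat2 1 0) + \<phi> (unit_mat2 1 1)"
proof -
  have add: "\<phi> (A + B) = \<phi> A + \<phi> B" and smult: "\<phi> (c \<cdot>\<^sub>m A) = c \<cdot>\<^sub>m \<phi> A"
    if "A \<in> carrier_mat 2 2" "B \<in> carrier_mat 2 2" for A B c
    using assms that by (auto simp: positive_maps_def linear_mat_map_def)
  show ?thesis unfolding outer_decomp
    by (simp add: add smult[OF _ unit_mat2_carrier])
qed

text \<open>The pencil is hermitian at \<open>a = 1\<close> and at \<open>a = \<i>\<close>. Once the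
  hermitian diagonal blocks are cancelled, the two values determine the sum and the difference of
  the off-diagonal entries.\<close>

lemma positive_maps_adjoint:
  assumes \<phi>: "\<phi> \<in> positive_maps 2 k"
  shows "mat_adjoint (\<phi> (unit_mat2 0 1)) = \<phi> (unit_mat2 1 0)"
proof (rule eq_matI)
  define h where "h i j = \<phi> (unit_mat2 i j)" for i j
  have hd [simp]: "dim_row (h i j) = k" "dim_col (h i j) = k" for i j
    using positive_mapsD(1)[OF \<phi>, of i j] by (auto simp: h_def)
  fix i j assume "i < dim_row (\<phi> (unit_mat2 1 0))" "j < dim_col (\<phi> (unit_mat2 1 0))"
  then have ij: "i < k" "j < k" using hd by (simp_all add: h_def)
  have herm: "A $$ (i, j) = cnj (A $$ (j, i))" if "positive_mat k A" for A
    using positive_matD(1,2)[OF that] ij by (metis carrier_matD mat_adjoint_index)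
  have e: "of_real ((cmod a)\<^sup>2) * h 0 0 $$ (i, j) + a * h 0 1 $$ (i, j)
     + cnj a * h 1 0 $$ (i, j) + h 1 1 $$ (i, j) = 
     of_real ((cmod a)\<^sup>2) * cnj (h 0 0 $$ (j, i)) + cnj a * cnj (h 0 1 $$ (j, i))
     + a * cnj (h 1 0 $$ (j, i)) + cnj (h 1 1 $$ (j, i))" for a
    using herm[OF positive_mapsD(4)[OF \<phi>, of a]] ij
    unfolding positive_maps_pencil[OF \<phi>] h_def[symmetric] by simp
  have 0: "h 0 0 $$ (i, j) = cnj (h 0 0 $$ (j, i))" "h 1 1 $$ (i, j) = cnj (h 1 1 $$ (j, i))"
    using herm positive_mapsD(2,3)[OF \<phi>] unfolding h_def by blast+
  have "h 0 1 $$ (i, j) + h 1 0 $$ (i, j) = cnj (h 0 1 $$ (j, i)) + cnj (h 1 0 $$ (j, i))"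
    using e[of 1] 0 by simp
  moreover have "\<i> * (h 0 1 $$ (i, j) - h 1 0 $$ (i, j)) = \<i> * (cnj (h 1 0 $$ (j, i)) - cnj (h 0 1 $$ (j, i)))"
    using e[of "\<i>"] 0 by (simp add: algebra_simps)
  then have "h 0 1 $$ (i, j) - h 1 0 $$ (i, j) = cnj (h 1 0 $$ (j, i)) - cnj (h 0 1 $$ (j, i))"
    by simp
  ultimately have "h 1 0 $$ (i, j) = cnj (h 0 1 $$ (j, i))" 
    by (simp add: complex_eq_iff)
  then show "mat_adjoint (\<phi> (unit_mat2 0 1)) $$ (i, j) = \<phi> (unit_mat2 1 0) $$ (i, j)"
    using ij unfolding h_def[symmetric] by simp
qed (use positive_mapsD(1)[OF \<phi>, of 0 1] positive_mapsD(1)[OF \<phi>, of 1 0] in auto)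

text \<open>The off-diagonal blocks are adjoint to each other, so their contributions at
  \<open>v\<close> are conjugate and add up to twice a real part.\<close>

lemma positive_maps_form:
  assumes \<phi>: "\<phi> \<in> positive_maps 2 k" and v: "v \<in> carrier_vec k"
  shows "0 \<le> (cmod a)\<^sup>2 * Re (cinner v (\<phi> (unit_mat2 0 0) *\<^sub>v v))
    + 2 * Re (a * cinner v (\<phi> (unit_mat2 0 1) *\<^sub>v v)) + Re (cinner v (\<phi> (unit_mat2 1 1) *\<^sub>v v))"
proof -
  define h where "h i j = \<phi> (unit_mat2 i j)" for i j
  have h [simp]: "h i j \<in> carrier_mat k k" for i j
    using positive_mapsD(1)[OF \<phi>] by (simp add: h_def)
  have [simp]: "dim_row (h i j) = k" "dim_col (h i j) = k" for i j
    by (rule carrier_matD[OF h])+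
  have smult: "cinner v ((c \<cdot>\<^sub>m A) *\<^sub>v v) = c * cinner v (A *\<^sub>v v)" if "A \<in> carrier_mat k k" for A c
    using that v by (simp add: smult_mat_mult_vec cinner_smult_right)
  have "cinner v (\<phi> (outer (vec2 a 1)) *\<^sub>v v) = of_real ((cmod a)\<^sup>2) * cinner v (h 0 0 *\<^sub>v v)
    + a * cinner v (h 0 1 *\<^sub>v v) + cnj a * cinner v (h 1 0 *\<^sub>v v) + cinner v (h 1 1 *\<^sub>v v)"
    unfolding positive_maps_pencil[OF \<phi>] h_def[symmetric] using v
    by (simp add: add_mult_distrib_mat_vec[of _ k k] cinner_add_right smult)
  moreover have "cinner v (h 1 0 *\<^sub>v v) = cnj (cinner v (h 0 1 *\<^sub>v v))"
    using cinner_mult_right[OF h v v, of 0 1] cinner_cnj[of "h 1 0 *\<^sub>v v" v] v 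
      positive_maps_adjoint[OF \<phi>] carrier_matD(1)[OF h, of 1 0] by (simp add: h_def)
  then have "Re (cnj a * cinner v (h 1 0 *\<^sub>v v)) = Re (a * cinner v (h 0 1 *\<^sub>v v))"
    by simp
  ultimately show ?thesis
    using positive_matD(3)[OF positive_mapsD(4)[OF \<phi>, of a] v]
    unfolding h_def[symmetric] by (simp add: Re_of_real_mult del: times_complex.sel of_real_power)
qed

text \<open>The pencil is evaluated at \<open>c x + y\<close>. As \<open>x\<close> is in the kernel
  of \<phi>(E22), that block contributes only its value at \<open>y\<close>, and the result has the
  shape required by \<open>pencil_inequality\<close>.\<close>

lemma positive_maps_kernel_inequality:
  assumes \<phi>: "\<phi> \<in> positive_maps 2 k" and x: "x \<in> carrier_vec k" and y: "y \<in> carrier_vec k"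
    and ker: "\<phi> (unit_mat2 1 1) *\<^sub>v x = 0\<^sub>v k"
  shows "(cmod (cinner x (\<phi> (unit_mat2 0 1) *\<^sub>v y)) + cmod (cinner y (\<phi> (unit_mat2 0 1) *\<^sub>v x)))\<^sup>2
    \<le> Re (cinner x (\<phi> (unit_mat2 0 0) *\<^sub>v x)) * Re (cinner y (\<phi> (unit_mat2 1 1) *\<^sub>v y))"
    and "cinner x (\<phi> (unit_mat2 0 1) *\<^sub>v x) = 0"
proof -
  define h where "h i j = \<phi> (unit_mat2 i j)" for i j
  have h [simp]: "h i j \<in> carrier_mat k k" for i j
    using positive_mapsD(1)[OF \<phi>] by (simp add: h_def)
  note pos = positive_maps_form[OF \<phi>, folded h_def]
  have ker: "h 1 1 *\<^sub>v x = 0\<^sub>v k" using ker by (simp add: h_def)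
  \<comment> \<open>In the expansion at \<open>c x + y\<close> this number is multiplied by
    \<open>a\<close> and the squared modulus of \<open>c\<close>. Under the scaling in
    \<open>pencil_inequality\<close> such a term is of order \<open>1 / s\<close>, so it has to
    vanish.\<close>
  have diag: "cinner x (h 0 1 *\<^sub>v x) = 0"
  proof -
    define q where "q = cinner x (h 0 1 *\<^sub>v x)"
    define Q where "Q = Re (cinner x (h 0 0 *\<^sub>v x))"
    have z: "cinner x (0\<^sub>v k) = 0" using x cinner_zero_right[of x] by simp
    obtain w where w: "cmod w = 1" "w * q = of_real (cmod q)" by (rule phase_ex)
    have "0 \<le> - 2 * cmod q"
    proof (rule limit_nonneg[of _ Q 0])
      fix s :: real assume s: "s > 0"
      \<comment> \<open>The constant term is absent because \<open>x\<close> is in the kernel;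
        division by \<open>s\<close> leaves an expression with limit
        \<open>- 2 * cmod q\<close>.\<close>
      have "0 \<le> s\<^sup>2 * Q - 2 * s * cmod q"
        using pos[OF x, of "- of_real s * w"] w s x z
        by (simp add: ker norm_mult Q_def q_def[symmetric] mult.assoc del: times_complex.sel
            flip: of_real_mult)
      also have "\<dots> = s * (- 2 * cmod q + Q * s + 0 * s\<^sup>2)"
        by (simp add: algebra_simps power2_eq_square)
      finally show "0 \<le> - 2 * cmod q + Q * s + 0 * s\<^sup>2"
        using s by (simp add: zero_le_mult_iff)
    qed
    then show ?thesis by (simp add: q_def)
  qed
  then show "cinner x (\<phi> (unit_mat2 0 1) *\<^sub>v x) = 0" by (simp add: h_def)
  show "(cmod (cinner x (\<phi> (unit_mat2 0 1) *\<^sub>v y)) + cmod (cinner y (\<phi> (unit_mat2 0 1) *\<^sub>v x)))\<^sup>2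
    \<le> Re (cinner x (\<phi> (unit_mat2 0 0) *\<^sub>v x)) * Re (cinner y (\<phi> (unit_mat2 1 1) *\<^sub>v y))"
    unfolding h_def[symmetric]
  proof (rule pencil_inequality)
    fix a c :: complex
    have v: "c \<cdot>\<^sub>v x + y \<in> carrier_vec k" using x y by simp
    have yx: "cinner y (h 1 1 *\<^sub>v x) = 0" "cinner x (h 1 1 *\<^sub>v x) = 0"
      using ker x y by (simp_all add: cinner_sum)
    \<comment> \<open>Hermiticity of \<phi>(E22) carries the vanishing over to the other cross
      term.\<close>
    have xy: "cinner x (h 1 1 *\<^sub>v y) = 0"
      using hermitian_cinner_swap[OF h _ y x, of 1 1] positive_matD(2)[OF positive_mapsD(3)[OF \<phi>]] yx
      by (simp add: h_def)
    show "0 \<le> (cmod a)\<^sup>2 * ((cmod c)\<^sup>2 * Re (cinner x (h 0 0 *\<^sub>v x))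
        + Re (cnj c * cinner x (h 0 0 *\<^sub>v y) + c * cinner y (h 0 0 *\<^sub>v x)) + Re (cinner y (h 0 0 *\<^sub>v y)))
      + 2 * Re (a * (cnj c * cinner x (h 0 1 *\<^sub>v y) + c * cinner y (h 0 1 *\<^sub>v x) + cinner y (h 0 1 *\<^sub>v y)))
      + Re (cinner y (h 1 1 *\<^sub>v y))"
      using pos[OF v, of a] unfolding cinner_expand[OF h x y] diag xy yx
      by (simp add: Re_of_real_mult add.assoc del: times_complex.sel of_real_power)
  qed
qed

text \<open>Polarisation: the form of \<phi>(E12) vanishes at \<open>x\<close>, \<open>y\<close> and
  \<open>c x + y\<close>, which all lie in the kernel, and the choices \<open>c = 1\<close> and
  \<open>c = \<i>\<close> separate the two mixed terms.\<close>

lemma positive_maps_kernel_zero: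
  assumes \<phi>: "\<phi> \<in> positive_maps 2 k" and x: "x \<in> carrier_vec k" and y: "y \<in> carrier_vec k"
    and kx: "\<phi> (unit_mat2 1 1) *\<^sub>v x = 0\<^sub>v k" and ky: "\<phi> (unit_mat2 1 1) *\<^sub>v y = 0\<^sub>v k"
  shows "cinner x (\<phi> (unit_mat2 0 1) *\<^sub>v y) = 0"
proof -
  define A where "A = \<phi> (unit_mat2 0 1)"
  define C where "C = \<phi> (unit_mat2 1 1)"
  have A: "A \<in> carrier_mat k k" "C \<in> carrier_mat k k" 
    using positive_mapsD(1)[OF \<phi>] by (simp_all add: A_def C_def)
  have "cnj c * cinner x (A *\<^sub>v y) + c * cinner y (A *\<^sub>v x) = 0" for c
  proof -
    have "c \<cdot>\<^sub>v 0\<^sub>v k = 0\<^sub>v k" by (rule eq_vecI) auto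
    then have "C *\<^sub>v (c \<cdot>\<^sub>v x + y) = 0\<^sub>v k"
      using A x y kx ky unfolding C_def[symmetric]
      by (simp add: mult_add_distrib_mat_vec[of _ k k] mult_mat_vec[of _ k k])
    then have "cinner (c \<cdot>\<^sub>v x + y) (A *\<^sub>v (c \<cdot>\<^sub>v x + y)) = 0"
      using positive_maps_kernel_inequality(2)[OF \<phi>, of "c \<cdot>\<^sub>v x + y"] x y by (simp add: A_def C_def)
    then show ?thesis
      unfolding cinner_expand[OF A(1) x y]
      using positive_maps_kernel_inequality(2)[OF \<phi> x x kx] positive_maps_kernel_inequality(2)[OF \<phi> y y ky]
      by (simp add: A_def)
  qed
  from this[of 1] this[of "\<i>"] show ?thesis unfolding A_def by (simp add: complex_eq_iff)
qed

section \<open>Householder reflections\<close>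

lemma unitary_mat_conj_one: "unitary_mat n S \<Longrightarrow> mat_adjoint S * 1\<^sub>m n * S = 1\<^sub>m n"
  using right_mult_one_mat[of "mat_adjoint S" n n] mat_adjoint_carrier[of S n n]
  by (simp add: unitary_mat_def)

lemma unitary_cinner:
  assumes S: "unitary_mat n S" and "x \<in> carrier_vec n" "y \<in> carrier_vec n"
  shows "cinner (S *\<^sub>v x) (S *\<^sub>v y) = cinner x y"
  using assms cinner_conj[of "1\<^sub>m n" n S n x y]
  by (simp add: unitary_mat_conj_one[OF S]) (simp add: unitary_mat_def)

text \<open>The reflection in the hyperplane orthogonal to \<open>w\<close> is a hermitian
  involution, hence unitary.\<close>

lemma householder_unitary:
  assumes w: "w \<in> carrier_vec n" and w0: "w \<noteq> 0\<^sub>v n"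
  obtains S where "unitary_mat n S"
    "\<And>v. v \<in> carrier_vec n \<Longrightarrow> S *\<^sub>v v = v - (2 * cinner w v / cinner w w) \<cdot>\<^sub>v w"
proof -
  have d [simp]: "dim_vec w = n" using w by simp
  have ww: "cinner w w \<noteq> 0" using w0 by (simp add: cinner_self_eq_0)
  define r where "r = Re (cinner w w)"
  have r: "cinner w w = of_real r" using cinner_self_Re[of w] by (simp add: r_def)
  define S where "S = 1\<^sub>m n + (- 2 / of_real r) \<cdot>\<^sub>m outer w"
  have S: "S \<in> carrier_mat n n" using w by (simp add: S_def)
  have Sv: "S *\<^sub>v v = v - (2 * cinner w v / cinner w w) \<cdot>\<^sub>v w" if v: "v \<in> carrier_vec n" for v
  proof -
    have "S *\<^sub>v v = v + (- 2 / of_real r) \<cdot>\<^sub>v (outer w *\<^sub>v v)"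
      using v w unfolding S_def
      by (subst add_mult_distrib_mat_vec[of _ n n]) (simp_all add: smult_mat_mult_vec carrier_matD[of "outer w" n n])
    then show ?thesis using v
      by (intro eq_vecI) (auto simp: outer_mult_vec r)
  qed
  have adj: "mat_adjoint S = S"
    by (rule eq_matI) (auto simp: S_def outer_def)
  have "S * S = 1\<^sub>m n"
  proof (rule mat_eq_by_vec)
    fix v :: "complex vec" assume v: "v \<in> carrier_vec n"
    have vd: "dim_vec v = n" using v by simp
    \<comment> \<open>The component along \<open>w\<close> changes sign, so the second reflection
      adds back what the first one subtracts.\<close>
    have c: "cinner w (S *\<^sub>v v) = - cinner w v"
      using v ww by (simp add: Sv cinner_minus_right cinner_smult_right)
    have "(S * S) *\<^sub>v v = S *\<^sub>v (S *\<^sub>v v)" using S v by simp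
    also have "\<dots> = S *\<^sub>v v - (2 * cinner w (S *\<^sub>v v) / cinner w w) \<cdot>\<^sub>v w"
      using S v by (intro Sv) simp
    also have "\<dots> = v" unfolding c unfolding Sv[OF v] using vd
      by (intro eq_vecI) auto
    finally show "(S * S) *\<^sub>v v = 1\<^sub>m n *\<^sub>v v" using v by simp
  qed (use S in auto)
  then have "unitary_mat n S" using S adj by (simp add: unitary_mat_def)
  then show ?thesis using Sv that by blast
qed

text \<open>The reflection along the difference of the basis vector and \<open>c x\<close> exchanges
  these two vectors, because \<open>c\<close> makes their scalar product real, and it fixes whatever
  is orthogonal to both.\<close>

lemma unitary_to_unit_vector:
  assumes i: "i < n" and x: "x \<in> carrier_vec n" and x1: "cinner x x = 1"
  obtains S c where "unitary_mat n S" "cmod c = 1" "S *\<^sub>v unit_vec n i = c \<cdot>\<^sub>v x"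
    "\<And>v. v \<in> carrier_vec n \<Longrightarrow> v $ i = 0 \<Longrightarrow> cinner x v = 0 \<Longrightarrow> S *\<^sub>v v = v"
proof -
  have d [simp]: "dim_vec x = n" using x by simp
  obtain c' where c': "cmod c' = 1" "c' * x $ i = of_real (cmod (x $ i))" by (rule phase_ex)
  \<comment> \<open>The minus sign makes \<open>c * x $ i\<close> nonpositive, so that
    \<open>cinner w w = 2 * (1 + r)\<close> stays nonzero even if \<open>x\<close> is a multiple of
    the basis vector.\<close>
  define c where "c = - c'"
  have c1: "cmod c = 1" using c' by (simp add: c_def)
  then have cc: "cnj c * c = 1" by (simp add: mult.commute flip: complex_norm_square)
  define r where "r = cmod (x $ i)"
  have r: "r \<ge> 0" by (simp add: r_def)
  have cx: "c * x $ i = - of_real r" using c' by (simp add: c_def r_def)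
  then have cx': "cnj c * cnj (x $ i) = - of_real r" by (metis complex_cnj_complex_of_real complex_cnj_minus complex_cnj_mult)
  define w where "w = unit_vec n i - c \<cdot>\<^sub>v x"
  have wd [simp]: "dim_vec w = n" and w: "w \<in> carrier_vec n" using x by (simp_all add: w_def)
  have we: "cinner w (unit_vec n i) = 1 + of_real r"
    using i x cx' by (simp add: w_def cinner_minus_left cinner_smult_left cinner_unit_left cinner_unit_right)
  have wx: "cinner w (c \<cdot>\<^sub>v x) = - (1 + of_real r)"
    using i x cx x1 cc by (simp add: w_def cinner_minus_left cinner_smult_left cinner_smult_right
      cinner_unit_left) (simp add: algebra_simps)
  have ww: "cinner w w = 2 * (1 + of_real r)"
  proof -
    have "cinner w w = cinner w (unit_vec n i) - cinner w (c \<cdot>\<^sub>v x)"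
      by (subst (2) w_def, rule cinner_minus_right) simp_all
    then show ?thesis unfolding we wx by simp
  qed
  have r1: "1 + complex_of_real r \<noteq> 0" using r
    by (metis of_real_1 of_real_add of_real_eq_0_iff add_nonneg_eq_0_iff zero_le_one zero_neq_one)
  then have "cinner w w \<noteq> 0" unfolding ww by (simp only: mult_eq_0_iff) simp
  then have "w \<noteq> 0\<^sub>v n" by (auto simp: cinner_zero_left)
  from householder_unitary[OF w this] obtain S where S: "unitary_mat n S"
    "\<And>v. v \<in> carrier_vec n \<Longrightarrow> S *\<^sub>v v = v - (2 * cinner w v / cinner w w) \<cdot>\<^sub>v w" by blast
  show ?thesis
  proof (rule that[OF S(1) c1])
    have "2 * (1 + complex_of_real r) / (2 * (1 + complex_of_real r)) = 1"
      by (rule divide_self) (simp only: mult_eq_0_iff r1, simp)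
    then have "S *\<^sub>v unit_vec n i = unit_vec n i - 1 \<cdot>\<^sub>v w"
      using S(2)[of "unit_vec n i"] unfolding we ww by simp
    then show "S *\<^sub>v unit_vec n i = c \<cdot>\<^sub>v x" using i by (intro eq_vecI) (auto simp: w_def)
    fix v :: "complex vec" assume v: "v \<in> carrier_vec n" "v $ i = 0" "cinner x v = 0"
    then have "cinner w v = 0"
      using i by (simp add: w_def cinner_minus_left cinner_smult_left cinner_unit_left)
    then show "S *\<^sub>v v = v" using v by (intro eq_vecI) (auto simp: S(2))
  qed
qed

section \<open>Positive square roots\<close>

lemma positive_mat_cnj:
  assumes "positive_mat n A" "i < n" "j < n"
  shows "cnj (A $$ (j, i)) = A $$ (i, j)"
  using positive_matD(2)[OF assms(1)] mat_adjoint_index[of i A j] carrier_matD[OF positive_matD(1)[OF assms(1)]]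
    assms(2,3) by simp

text \<open>\<open>D = R - S\<close> satisfies \<open>R D + D S = 0\<close>, so the positive matrices \<open>D R D\<close> and \<open>D S D\<close> have traces
  with sum \<open>0\<close>; hence \<open>R D = S D = 0\<close> and \<open>D\<^sup>2 = 0\<close>.\<close>

lemma positive_sqrt_unique:
  assumes R: "positive_mat n R" and S: "positive_mat n S" and eq: "R * R = S * S"
  shows "R = S"
proof -
  note RD = positive_matD[OF R] and SD = positive_matD[OF S]
  note c [simp] = RD(1) SD(1)
  define D where "D = R - S"
  have D [simp]: "D \<in> carrier_mat n n" unfolding D_def by (rule minus_carrier_mat) (rule SD(1))
  have adj: "mat_adjoint D = D"
    using positive_mat_cnj[OF R] positive_mat_cnj[OF S] carrier_matD[OF RD(1)] carrier_matD[OF SD(1)]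
    by (intro eq_matI) (simp_all add: D_def)
  have anti: "R * D + D * S = 0\<^sub>m n n"
  proof -
    have "R * D + D * S = (R * R - R * S) + (R * S - S * S)"
      unfolding D_def mult_minus_distrib_mat[OF RD(1) RD(1) SD(1)] minus_mult_distrib_mat[OF RD(1) SD(1) SD(1)] ..
    also have "\<dots> = 0\<^sub>m n n" unfolding eq
      using carrier_matD[OF RD(1)] carrier_matD[OF SD(1)] by (intro eq_matI) auto
    finally show ?thesis .
  qed
  define tr where "tr A = (\<Sum>i<n. A $$ (i, i))" for A :: "complex mat"
  have tr_mult: "tr (A * B) = tr (B * A)" if "A \<in> carrier_mat n n" "B \<in> carrier_mat n n" for A B
  proof -
    have "tr (A * B) = (\<Sum>i<n. \<Sum>j<n. A $$ (i, j) * B $$ (j, i))"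
      using that by (simp add: tr_def scalar_prod_def atLeast0LessThan)
    also have "\<dots> = (\<Sum>j<n. \<Sum>i<n. A $$ (i, j) * B $$ (j, i))" by (rule sum.swap)
    also have "\<dots> = tr (B * A)"
      using that by (simp add: tr_def scalar_prod_def atLeast0LessThan mult.commute)
    finally show ?thesis .
  qed
  have tr_add: "tr (A + B) = tr A + tr B" if "A \<in> carrier_mat n n" "B \<in> carrier_mat n n" for A B
    using that by (simp add: tr_def sum.distrib)
  \<comment> \<open>Cyclicity of the trace brings both products to the common left factor
    \<open>D\<close>, so that \<open>anti\<close> applies.\<close>
  have "tr (D * R * D) + tr (D * S * D) = tr (D * (R * D)) + tr (D * (D * S))"
    using tr_mult[of "D * S" D] by (simp add: assoc_mult_mat[of D n n R n D n])
  also have "\<dots> = tr (D * (R * D + D * S))"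
    using mult_carrier_mat[OF RD(1) D] mult_carrier_mat[OF D SD(1)]
    by (subst tr_add[symmetric]) (simp_all add: mult_add_distrib_mat[of D n n "R * D" n "D * S"] mult_carrier_mat[OF D])
  also have "\<dots> = 0" unfolding anti using right_mult_zero_mat[OF D, of n] by (simp add: tr_def)
  finally have "(\<Sum>i<n. (D * R * D) $$ (i, i) + (D * S * D) $$ (i, i)) = 0"
    by (simp add: tr_def sum.distrib)
  from arg_cong[OF this, of Re]
  have sum0: "(\<Sum>i<n. Re ((D * R * D) $$ (i, i)) + Re ((D * S * D) $$ (i, i))) = 0"
    by (simp only: Re_sum plus_complex.sel zero_complex.sel)
  have diag: "(D * A * D) $$ (i, i) = cinner (D *\<^sub>v unit_vec n i) (A *\<^sub>v (D *\<^sub>v unit_vec n i))"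
    if "i < n" "A \<in> carrier_mat n n" for i A
    using that mult_carrier_mat[OF mult_carrier_mat[OF D that(2)] D]
      cinner_conj[of A n D n "unit_vec n i" "unit_vec n i"] cinner_unit_mat[of "D * A * D" n i i]
    by (simp add: adj)
  have Du [simp]: "D *\<^sub>v unit_vec n j \<in> carrier_vec n" for j
    by (rule mult_mat_vec_carrier[OF D unit_vec_carrier])
  have De: "D *\<^sub>v unit_vec n i = 0\<^sub>v n" if i: "i < n" for i
  proof -
    define u where "u = D *\<^sub>v unit_vec n i"
    have u: "u \<in> carrier_vec n" by (simp add: u_def)
    have nn: "0 \<le> Re ((D * R * D) $$ (j, j))" "0 \<le> Re ((D * S * D) $$ (j, j))" if "j < n" for j
      using that RD(3) SD(3) by (simp_all add: diag)
    then have "Re ((D * R * D) $$ (i, i)) + Re ((D * S * D) $$ (i, i)) = 0"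
      using sum0 i by (subst (asm) sum_nonneg_eq_0_iff) auto
    then have "Re (cinner u (R *\<^sub>v u)) = 0" "Re (cinner u (S *\<^sub>v u)) = 0"
      using nn[OF i] i by (simp_all add: diag u_def)
    then have "R *\<^sub>v u = 0\<^sub>v n" "S *\<^sub>v u = 0\<^sub>v n"
      using positive_mat_kernel R S u by blast+
    then have "D *\<^sub>v u = 0\<^sub>v n"
      using u by (simp add: D_def minus_mult_distrib_mat_vec[of _ n n])
    \<comment> \<open>\<open>u\<close> is a column of the hermitian matrix \<open>D\<close>, so
      \<open>cinner u u\<close> is the scalar product of a basis vector with
      \<open>D u = 0\<close>.\<close>
    then have "cinner u u = 0"
      using cinner_mult_right[of D n n "unit_vec n i" u] u cinner_mult_left[of D n n u "unit_vec n i"]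
      by (simp add: adj u_def cinner_sum)
    then show ?thesis using u carrier_matD(1)[OF D] by (simp add: cinner_self_eq_0 u_def)
  qed
  have "R $$ (i, j) = S $$ (i, j)" if "i < n" "j < n" for i j
  proof -
    have "D $$ (i, j) = 0" using De[of j] cinner_unit_mat[OF D, of i j] that by (simp add: cinner_unit_left)
    then show ?thesis using that carrier_matD[OF RD(1)] carrier_matD[OF SD(1)] by (simp add: D_def)
  qed
  then show ?thesis using carrier_matD[OF RD(1)] carrier_matD[OF SD(1)] by (intro eq_matI) auto
qed

section \<open>Direct sums of a number and a matrix, and the existence of positive square
  roots\<close>

definition bordered_mat :: "complex \<Rightarrow> complex mat \<Rightarrow> complex mat" where
  "bordered_mat c B = mat (Suc (dim_row B)) (Suc (dim_col B))
     (\<lambda>(i, j). if i = 0 \<and> j = 0 then c else if i = 0 \<or> j = 0 then 0 else B $$ (i - 1, j - 1))"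

lemma bordered_mat_carrier [simp]: "B \<in> carrier_mat n n \<Longrightarrow> bordered_mat c B \<in> carrier_mat (Suc n) (Suc n)"
  by (auto simp: bordered_mat_def)

lemma bordered_mat_mult:
  assumes "B \<in> carrier_mat n n" "C \<in> carrier_mat n n"
  shows "bordered_mat c B * bordered_mat d C = bordered_mat (c * d) (B * C)"
  using assms
  by (intro eq_matI)
    (auto simp: bordered_mat_def scalar_prod_def atLeast0LessThan sum.lessThan_Suc_shift less_Suc_eq_0_disj
      simp del: sum.lessThan_Suc)

lemma bordered_mat_mult_vec:
  assumes "dim_vec w = dim_col B"
  shows "bordered_mat c B *\<^sub>v vCons a w = vCons (c * a) (B *\<^sub>v w)"
  using assms
  by (intro eq_vecI)
    (auto simp: bordered_mat_def scalar_prod_def atLeast0LessThan sum.lessThan_Suc_shift less_Suc_eq_0_disj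
      simp del: sum.lessThan_Suc)

lemma cinner_vCons: "cinner (vCons a v) (vCons b w) = cnj a * b + cinner v w"
  by (simp add: cinner_sum sum.lessThan_Suc_shift del: sum.lessThan_Suc)

lemma positive_bordered_mat:
  assumes B: "positive_mat n B" and l: "l \<ge> 0"
  shows "positive_mat (Suc n) (bordered_mat (of_real l) B)"
  unfolding positive_mat_def
proof (intro conjI ballI)
  note BD = positive_matD[OF B]
  note d [simp] = carrier_matD[OF BD(1)]
  show "bordered_mat (of_real l) B \<in> carrier_mat (Suc n) (Suc n)" using BD by simp
  show "mat_adjoint (bordered_mat (of_real l) B) = bordered_mat (of_real l) B"
    using positive_mat_cnj[OF B] by (intro eq_matI) (auto simp: bordered_mat_def less_Suc_eq_0_disj)
  fix v :: "complex vec" assume v: "v \<in> carrier_vec (Suc n)"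
  then obtain a w where vw: "v = vCons a w" and w: "w \<in> carrier_vec n" by (cases v) auto
  have "cinner v (bordered_mat (of_real l) B *\<^sub>v v) = of_real l * (cnj a * a) + cinner w (B *\<^sub>v w)"
    using bordered_mat_mult_vec[of w B] w by (simp add: vw cinner_vCons)
  also have "cnj a * a = of_real ((cmod a)\<^sup>2)"
    by (simp add: complex_norm_square mult.commute del: of_real_power)
  finally show "0 \<le> Re (cinner v (bordered_mat (of_real l) B *\<^sub>v v))"
    using l BD(3)[OF w] by (simp del: of_real_power)
qed

lemma unitary_mult_vec:
  assumes S: "unitary_mat n S" and u: "u \<in> carrier_vec n"
  shows "mat_adjoint S *\<^sub>v (S *\<^sub>v u) = u" "S *\<^sub>v (mat_adjoint S *\<^sub>v u) = u"
proof -
  have c: "S \<in> carrier_mat n n" "mat_adjoint S \<in> carrier_mat n n" using S by (auto simp: unitary_mat_def)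
  show "mat_adjoint S *\<^sub>v (S *\<^sub>v u) = u"
    using assoc_mult_mat_vec[OF c(2,1) u] S u by (simp add: unitary_mat_def)
  show "S *\<^sub>v (mat_adjoint S *\<^sub>v u) = u"
    using assoc_mult_mat_vec[OF c u] S u by (simp add: unitary_mat_def)
qed

text \<open>An eigenvalue exists since the dimension is positive. At a normalised eigenvector it
  equals the value of the form, which is real by hermiticity and nonnegative by positivity.\<close>

lemma unit_eigenvector_ex:
  assumes A: "positive_mat n A" and n: "n > 0"
  obtains l x where "l \<ge> 0" "x \<in> carrier_vec n" "cinner x x = 1" "A *\<^sub>v x = of_real l \<cdot>\<^sub>v x"
proof -
  note AD = positive_matD[OF A]
  obtain m where "eigenvalue A m" using spectrum_non_empty[OF AD(1) n] by (auto simp: spectrum_def)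
  then obtain v where v: "v \<in> carrier_vec n" "v \<noteq> 0\<^sub>v n" "A *\<^sub>v v = m \<cdot>\<^sub>v v"
    using carrier_matD[OF AD(1)] by (auto simp: eigenvalue_def eigenvector_def)
  define r where "r = Re (cinner v v)"
  have r: "cinner v v = of_real r" using cinner_self_Re[of v] by (simp add: r_def)
  have "r \<noteq> 0" using v(1,2) cinner_self_Re_eq_0[of v] by (simp add: r_def)
  then have "r > 0" using cinner_self_nonneg[of v] by (simp add: r_def)
  define x where "x = (1 / of_real (sqrt r)) \<cdot>\<^sub>v v"
  have x: "x \<in> carrier_vec n" using v by (simp add: x_def)
  have "complex_of_real (sqrt r) * of_real (sqrt r) = of_real r"
    using \<open>r > 0\<close> by (simp flip: of_real_mult)
  then have x1: "cinner x x = 1"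
    using \<open>r > 0\<close> by (simp add: x_def cinner_smult_left cinner_smult_right r)
  have Ax: "A *\<^sub>v x = m \<cdot>\<^sub>v x"
    using v mult_mat_vec[OF AD(1) v(1)] by (simp add: x_def smult_smult_assoc mult.commute)
  have m: "cinner x (A *\<^sub>v x) = m" using x x1 by (simp add: Ax cinner_smult_right)
  then have "cnj m = m" using hermitian_cinner_swap[OF AD(1,2) x x] by simp
  then have "m = of_real (Re m)" by (simp add: complex_eq_iff)
  moreover have "Re m \<ge> 0" using AD(3)[OF x] m by simp
  ultimately show ?thesis using that[of "Re m" x] x x1 Ax by simp
qed

text \<open>Induction on the dimension: a unitary that sends the first basis vector to a multiple of
  a unit eigenvector turns \<open>A\<close> into the direct sum of \<open>l\<close> and a smaller
  positive matrix, and the root of that sum is conjugated back.\<close>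

lemma positive_sqrt_exists:
  "positive_mat n A \<Longrightarrow> \<exists>R. positive_mat n R \<and> R * R = A"
proof (induction n arbitrary: A)
  case 0
  \<comment> \<open>All matrices of size \<open>0\<close> are equal, so \<open>A\<close> is its own
    root.\<close>
  then have "A * A = A" using positive_matD(1)[OF 0] by (intro eq_matI) auto
  then show ?case using 0 by blast
next
  case (Suc n)
  note A = \<open>positive_mat (Suc n) A\<close>
  note AD = positive_matD[OF A]
  obtain l x where l: "l \<ge> 0" and x: "x \<in> carrier_vec (Suc n)" "cinner x x = 1"
    and Ax: "A *\<^sub>v x = of_real l \<cdot>\<^sub>v x" by (rule unit_eigenvector_ex[OF A]) auto
  obtain S c where S: "unitary_mat (Suc n) S" and Se: "S *\<^sub>v unit_vec (Suc n) 0 = c \<cdot>\<^sub>v x"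
    by (rule unitary_to_unit_vector[OF _ x]) auto
  have Sc: "S \<in> carrier_mat (Suc n) (Suc n)" using S by (simp add: unitary_mat_def)
  define M where "M = mat_adjoint S * A * S"
  have Mpos: "positive_mat (Suc n) M" unfolding M_def by (rule positive_mat_conj[OF A Sc])
  note MD = positive_matD[OF Mpos]
  note dM [simp] = carrier_matD[OF MD(1)]
  \<comment> \<open>Only the first column is computed; the first row follows below because
    \<open>M\<close> is hermitian.\<close>
  have Me: "M $$ (i, 0) = (if i = 0 then of_real l else 0)" if i: "i < Suc n" for i
  proof -
    have "M $$ (i, 0) = cinner (S *\<^sub>v unit_vec (Suc n) i) (A *\<^sub>v (S *\<^sub>v unit_vec (Suc n) 0))"
      using cinner_conj[OF AD(1) Sc, of "unit_vec (Suc n) i" "unit_vec (Suc n) 0"] cinner_unit_mat[OF MD(1) i, of 0]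
      by (simp add: M_def)
    also have "A *\<^sub>v (S *\<^sub>v unit_vec (Suc n) 0) = of_real l \<cdot>\<^sub>v (S *\<^sub>v unit_vec (Suc n) 0)"
      unfolding Se using x mult_mat_vec[OF AD(1) x(1)] by (simp add: Ax smult_smult_assoc mult.commute)
    also have "cinner (S *\<^sub>v unit_vec (Suc n) i) \<dots> = of_real l * cinner (unit_vec (Suc n) i) (unit_vec (Suc n) 0)"
      using Sc by (simp add: cinner_smult_right unitary_cinner[OF S])
    finally show ?thesis using i by (simp add: cinner_unit_left)
  qed
  \<comment> \<open>\<open>J\<close> embeds the smaller space as the last coordinates, so the lower
    right block of \<open>M\<close> is a compression of \<open>M\<close> and inherits
    positivity.\<close>
  define J where "J = mat (Suc n) n (\<lambda>(i, j). if i = Suc j then 1 else 0 :: complex)"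
  have J: "J \<in> carrier_mat (Suc n) n" by (simp add: J_def)
  define A' where "A' = mat n n (\<lambda>(i, j). M $$ (Suc i, Suc j))"
  have A'c: "A' \<in> carrier_mat n n" by (simp add: A'_def)
  have Je: "J *\<^sub>v unit_vec n j = unit_vec (Suc n) (Suc j)" if "j < n" for j
    using that by (intro eq_vecI) (auto simp: J_def)
  have JMJ: "mat_adjoint J * M * J \<in> carrier_mat n n" using J MD(1) by auto
  have "A' = mat_adjoint J * M * J"
  proof (rule eq_matI)
    fix i j assume "i < dim_row (mat_adjoint J * M * J)" "j < dim_col (mat_adjoint J * M * J)"
    then have ij: "i < n" "j < n" using JMJ by auto
    then show "A' $$ (i, j) = (mat_adjoint J * M * J) $$ (i, j)"
      using cinner_conj[OF MD(1) J, of "unit_vec n i" "unit_vec n j"] cinner_unit_mat[OF JMJ ij]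
        cinner_unit_mat[OF MD(1), of "Suc i" "Suc j"]
      by (simp add: Je A'_def)
  qed (use JMJ A'c in auto)
  then have "positive_mat n A'" using positive_mat_conj[OF Mpos J] by simp
  from Suc.IH[OF this] obtain R' where R': "positive_mat n R'" "R' * R' = A'" by blast
  have M: "M = bordered_mat (of_real l) A'"
  proof (rule eq_matI)
    fix i j assume "i < dim_row (bordered_mat (of_real l) A')" "j < dim_col (bordered_mat (of_real l) A')"
    then have ij: "i < Suc n" "j < Suc n" by (auto simp: bordered_mat_def A'_def)
    have "M $$ (i, j) = cnj (M $$ (j, i))" using positive_mat_cnj[OF Mpos ij] by simp
    then show "M $$ (i, j) = bordered_mat (of_real l) A' $$ (i, j)"
      using ij Me[of i] Me[of j] by (auto simp: bordered_mat_def A'_def)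
  qed (auto simp: bordered_mat_def A'_def)
  define Q where "Q = bordered_mat (of_real (sqrt l)) R'"
  have Q: "positive_mat (Suc n) Q" unfolding Q_def using R' l by (intro positive_bordered_mat) auto
  have Qc: "Q \<in> carrier_mat (Suc n) (Suc n)" using positive_matD(1)[OF Q] .
  have QQ: "Q * Q = M"
    unfolding Q_def M bordered_mat_mult[OF positive_matD(1)[OF R'(1)] positive_matD(1)[OF R'(1)]] R'(2)
    using l by (simp flip: of_real_mult)
  define R where "R = S * Q * mat_adjoint S"
  have Rc: "R \<in> carrier_mat (Suc n) (Suc n)" using Qc Sc by (auto simp: R_def)
  have Rv: "R *\<^sub>v v = S *\<^sub>v (Q *\<^sub>v (mat_adjoint S *\<^sub>v v))" if "v \<in> carrier_vec (Suc n)" for v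
  proof -
    have "mat_adjoint S *\<^sub>v v \<in> carrier_vec (Suc n)"
      by (rule mult_mat_vec_carrier[OF mat_adjoint_carrier[OF Sc] that])
    then show ?thesis
      using assoc_mult_mat_vec[OF _ mat_adjoint_carrier[OF Sc] that, of "S * Q" "Suc n"]
        assoc_mult_mat_vec[OF Sc Qc] Sc Qc by (simp add: R_def)
  qed
  have Mv: "M *\<^sub>v v = mat_adjoint S *\<^sub>v (A *\<^sub>v (S *\<^sub>v v))" if "v \<in> carrier_vec (Suc n)" for v
  proof -
    have "S *\<^sub>v v \<in> carrier_vec (Suc n)" by (rule mult_mat_vec_carrier[OF Sc that])
    then show ?thesis
      using assoc_mult_mat_vec[OF _ Sc that, of "mat_adjoint S * A" "Suc n"] mat_adjoint_carrier[OF Sc]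
        assoc_mult_mat_vec[OF mat_adjoint_carrier[OF Sc] AD(1)] AD(1) by (simp add: M_def)
  qed
  have "R * R = A"
  proof (rule mat_eq_by_vec[OF _ AD(1)])
    fix v :: "complex vec" assume v: "v \<in> carrier_vec (Suc n)"
    define w where "w = mat_adjoint S *\<^sub>v v"
    have w: "w \<in> carrier_vec (Suc n)" 
      unfolding w_def by (rule mult_mat_vec_carrier[OF mat_adjoint_carrier[OF Sc] v])
    have "(R * R) *\<^sub>v v = R *\<^sub>v (R *\<^sub>v v)" using Rc v by simp
    also have "\<dots> = S *\<^sub>v (Q *\<^sub>v (mat_adjoint S *\<^sub>v (S *\<^sub>v (Q *\<^sub>v w))))"
      unfolding Rv[OF mult_mat_vec_carrier[OF Rc v]] unfolding Rv[OF v] w_def ..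
    also have "\<dots> = S *\<^sub>v (Q *\<^sub>v (Q *\<^sub>v w))"
      using unitary_mult_vec(1)[OF S, of "Q *\<^sub>v w"] Qc w by simp
    also have "Q *\<^sub>v (Q *\<^sub>v w) = M *\<^sub>v w" using Qc w by (simp flip: QQ)
    also have "S *\<^sub>v (M *\<^sub>v w) = A *\<^sub>v v"
      using unitary_mult_vec(2)[OF S] v AD(1) unfolding Mv[OF w] by (simp add: w_def)
    finally show "(R * R) *\<^sub>v v = A *\<^sub>v v" .
  qed (use Rc in auto)
  moreover have "positive_mat (Suc n) R"
    using positive_mat_conj[OF Q mat_adjoint_carrier[OF Sc]] by (simp add: R_def)
  ultimately show ?case by blast
qed

text \<open>Uniqueness of the positive root makes the description in \<open>sqrt_mat\<close>
  definite, so any root found by inspection is its value.\<close>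

lemma sqrt_mat_eqI:
  assumes R: "positive_mat n R" and A: "R * R = A"
  shows "sqrt_mat A = R"
proof -
  have n: "dim_row A = n" using carrier_matD[OF positive_matD(1)[OF R]] by (simp flip: A)
  show ?thesis unfolding sqrt_mat_def n
  proof (rule the_equality)
    show "positive_mat n R \<and> R * R = A" using R A by simp
    fix R' assume "positive_mat n R' \<and> R' * R' = A"
    then show "R' = R" by (intro positive_sqrt_unique[OF _ R]) (simp_all add: A)
  qed
qed

lemma sqrt_mat_square:
  assumes "positive_mat n A"
  shows "positive_mat n (sqrt_mat A)" "sqrt_mat A * sqrt_mat A = A"
proof -
  obtain R where R: "positive_mat n R" "R * R = A" using positive_sqrt_exists[OF assms] by blast
  then show "positive_mat n (sqrt_mat A)" "sqrt_mat A * sqrt_mat A = A"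
    unfolding sqrt_mat_eqI[OF R] using R by simp_all
qed

section \<open>Rank one matrices and the common direction\<close>

text \<open>The vector \<open>conjugate (row Y 0)\<close> stands for the column \<open>Y^*\<close>,
  which turns \<open>Y v\<close> into a scalar product.\<close>

lemma cinner_conjugate_row:
  assumes "Y \<in> carrier_mat 1 n" "v \<in> carrier_vec n"
  shows "cinner (conjugate (row Y 0)) v = (\<Sum>j<n. Y $$ (0, j) * v $ j)"
  using assms by (auto simp: cinner_sum)

lemma adjoint_mult_row:
  assumes "Y \<in> carrier_mat 1 n"
  shows "mat_adjoint Y * Y = outer (conjugate (row Y 0))"
  using assms by (intro eq_matI) (auto simp: outer_def scalar_prod_def atLeast0LessThan lessThan_nat_numeral One_nat_def)

lemma outer_smult: "outer (c \<cdot>\<^sub>v x) = of_real ((cmod c)\<^sup>2) \<cdot>\<^sub>m outer x"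
  by (intro eq_matI) (auto simp: outer_def complex_norm_square simp del: of_real_power)

text \<open>For a unit vector \<open>outer x\<close> is idempotent, so its multiples multiply like
  numbers.\<close>

lemma outer_square:
  assumes "x \<in> carrier_vec n" "cinner x x = 1"
  shows "(a \<cdot>\<^sub>m outer x) * (b \<cdot>\<^sub>m outer x) = (a * b) \<cdot>\<^sub>m outer x"
proof (rule mat_eq_by_vec[of _ n])
  show "(a \<cdot>\<^sub>m outer x) * (b \<cdot>\<^sub>m outer x) \<in> carrier_mat n n" "(a * b) \<cdot>\<^sub>m outer x \<in> carrier_mat n n"
    using outer_carrier[OF assms(1)] by (auto intro: mult_carrier_mat[of _ n n])
  fix v :: "complex vec" assume v: "v \<in> carrier_vec n"
  have c: "outer x \<in> carrier_mat n n" using assms(1) by simp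
  have "((a \<cdot>\<^sub>m outer x) * (b \<cdot>\<^sub>m outer x)) *\<^sub>v v = (a \<cdot>\<^sub>m outer x) *\<^sub>v ((b \<cdot>\<^sub>m outer x) *\<^sub>v v)"
    using c v by (intro assoc_mult_mat_vec[of _ n n _ n]) auto
  also have "\<dots> = (a * b) \<cdot>\<^sub>m outer x *\<^sub>v v"
    using assms v carrier_matD[OF c]
    by (intro eq_vecI) (auto simp: smult_mat_mult_vec outer_mult_vec cinner_smult_right)
  finally show "((a \<cdot>\<^sub>m outer x) * (b \<cdot>\<^sub>m outer x)) *\<^sub>v v = (a * b) \<cdot>\<^sub>m outer x *\<^sub>v v" .
qed

lemma positive_smult:
  assumes A: "positive_mat n A" and c: "c \<ge> 0"
  shows "positive_mat n (of_real c \<cdot>\<^sub>m A)"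
  unfolding positive_mat_def
proof (intro conjI ballI)
  note AD = positive_matD[OF A]
  show "complex_of_real c \<cdot>\<^sub>m A \<in> carrier_mat n n" using AD by simp
  show "mat_adjoint (complex_of_real c \<cdot>\<^sub>m A) = complex_of_real c \<cdot>\<^sub>m A"
    using carrier_matD[OF AD(1)] positive_mat_cnj[OF A] by (intro eq_matI) auto
  fix v :: "complex vec" assume v: "v \<in> carrier_vec n"
  then show "0 \<le> Re (cinner v ((complex_of_real c \<cdot>\<^sub>m A) *\<^sub>v v))"
    using carrier_matD[OF AD(1)] AD(3)[OF v] c by (simp add: smult_mat_mult_vec cinner_smult_right)
qed

text \<open>\<open>Y^* Y\<close> is the squared modulus of \<open>a\<close> times the projection
  \<open>outer x\<close>, and the right-hand side is positive with this square.\<close>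

lemma abs_mat_row:
  assumes Y: "Y \<in> carrier_mat 1 n" and x: "x \<in> carrier_vec n" "cinner x x = 1"
    and eq: "conjugate (row Y 0) = a \<cdot>\<^sub>v x"
  shows "abs_mat Y = of_real (cmod a) \<cdot>\<^sub>m outer x"
  unfolding abs_mat_def
proof (rule sqrt_mat_eqI)
  show "positive_mat n (of_real (cmod a) \<cdot>\<^sub>m outer x)"
    by (intro positive_smult positive_outer x) simp
  show "(of_real (cmod a) \<cdot>\<^sub>m outer x) * (of_real (cmod a) \<cdot>\<^sub>m outer x) = mat_adjoint Y * Y"
    unfolding outer_square[OF x] adjoint_mult_row[OF Y] eq outer_smult by (simp add: power2_eq_square)
qed

lemma unit_vector_decomposition:
  assumes p: "p \<in> carrier_vec n" and n: "n > 0"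
  obtains a e where "a \<ge> 0" "e \<in> carrier_vec n" "cinner e e = 1" "p = of_real a \<cdot>\<^sub>v e"
proof (cases "p = 0\<^sub>v n")
  case True
  show ?thesis
    \<comment> \<open>The zero vector has no direction of its own; the first basis vector, available
      since \<open>n > 0\<close>, serves as the default.\<close>
    by (rule that[of 0 "unit_vec n 0"]) (use True n in \<open>auto simp: cinner_unit_left\<close>)
next
  case False
  define r where "r = Re (cinner p p)"
  have r: "cinner p p = of_real r" using cinner_self_Re[of p] by (simp add: r_def)
  have "r \<noteq> 0" using p False cinner_self_Re_eq_0[of p] by (simp add: r_def)
  then have "r > 0" using cinner_self_nonneg[of p] by (simp add: r_def)
  have rr: "complex_of_real (sqrt r) * of_real (sqrt r) = of_real r"
    using \<open>r > 0\<close> by (simp flip: of_real_mult)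
  show ?thesis
  proof (rule that[of "sqrt r" "(1 / of_real (sqrt r)) \<cdot>\<^sub>v p"])
    show "cinner ((1 / of_real (sqrt r)) \<cdot>\<^sub>v p) ((1 / of_real (sqrt r)) \<cdot>\<^sub>v p) = 1"
      using \<open>r > 0\<close> rr by (simp add: cinner_smult_left cinner_smult_right r)
    show "p = of_real (sqrt r) \<cdot>\<^sub>v ((1 / of_real (sqrt r)) \<cdot>\<^sub>v p)"
      using \<open>r > 0\<close> by (simp add: smult_smult_assoc)
  qed (use p \<open>r > 0\<close> in auto)
qed

text \<open>With \<open>g = cinner e f\<close>, the hypothesis at \<open>v = e\<close> gives
  \<open>cmod g \<ge> 1\<close> unless \<open>g = 0\<close>, and at \<open>v = e + f\<close> it
  excludes \<open>g = 0\<close>. The component of \<open>f\<close> orthogonal to \<open>e\<close>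
  has squared norm \<open>1 - (cmod g)\<^sup>2\<close>, so it vanishes.\<close>

lemma unit_vectors_parallel:
  assumes e: "e \<in> carrier_vec n" "cinner e e = 1" and f: "f \<in> carrier_vec n" "cinner f f = 1"
    and ineq: "\<And>v. v \<in> carrier_vec n \<Longrightarrow>
      cmod (cinner e v) * cmod (cinner f v) \<le> Re (cnj (cinner e v) * cinner f v * cinner e f)"
  shows "f = cinner e f \<cdot>\<^sub>v e"
proof -
  define g where "g = cinner e f"
  have ed [simp]: "dim_vec e = n" "dim_vec f = n" using e f by auto
  have gc: "cinner f e = cnj g" using cinner_cnj[of e f] by (simp add: g_def)
  have g1: "cmod g \<ge> 1"
  proof (cases "g = 0")
    case True
    then show ?thesis
      using ineq[of "e + f"] e f gc
      by (simp add: cinner_add_right g_def[symmetric])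
  next
    case False
    have "cmod g \<le> Re (cnj g * g)" using ineq[OF e(1)] e(2) gc by (simp add: g_def[symmetric])
    also have "\<dots> = cmod g * cmod g"
      by (simp add: cmod_power2 flip: power2_eq_square)
    finally show ?thesis using False by simp
  qed
  define w where "w = f - g \<cdot>\<^sub>v e"
  have "cinner w w = 1 - cnj g * g"
    using e f gc by (simp add: w_def cinner_minus_left cinner_minus_right cinner_smult_left
        cinner_smult_right g_def[symmetric] algebra_simps)
  also have "cnj g * g = of_real ((cmod g)\<^sup>2)"
    by (simp add: complex_norm_square mult.commute del: of_real_power)
  finally have "Re (cinner w w) = 1 - (cmod g)\<^sup>2" by (simp del: of_real_power)
  then have "Re (cinner w w) = 0" using cinner_self_nonneg[of w] one_le_power[OF g1, of 2] by simp
  then have w0: "w = 0\<^sub>v n" unfolding cinner_self_Re_eq_0 by (simp add: w_def)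
  have "f $ i = (g \<cdot>\<^sub>v e) $ i" if "i < n" for i
    using arg_cong[OF w0, of "\<lambda>u. u $ i"] that by (simp add: w_def)
  then show ?thesis by (intro eq_vecI) (auto simp: g_def)
qed

text \<open>By \<open>abs_sum\<close>, \<open>cinner v (U v)\<close> is the squared norm of
  \<open>(|Y| + |Z|) v\<close>. Comparing it with the lower bound in \<open>ineq\<close> forces
  equality in the Cauchy-Schwarz inequality for the directions of the two rows.\<close>

lemma rows_common_direction:
  assumes n: "n > 0" and Y: "Y \<in> carrier_mat 1 n" and Z: "Z \<in> carrier_mat 1 n"
    and U: "positive_mat n U" and abs_sum: "abs_mat Y + abs_mat Z = sqrt_mat U"
    and ineq: "\<And>v. v \<in> carrier_vec n \<Longrightarrow>
      (cmod (cinner (conjugate (row Y 0)) v) + cmod (cinner (conjugate (row Z 0)) v))\<^sup>2 \<le> Re (cinner v (U *\<^sub>v v))"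
  obtains e a b where "e \<in> carrier_vec n" "cinner e e = 1" "conjugate (row Y 0) = a \<cdot>\<^sub>v e"
    "conjugate (row Z 0) = b \<cdot>\<^sub>v e" "U = of_real ((cmod a + cmod b)\<^sup>2) \<cdot>\<^sub>m outer e"
proof -
  have "\<exists>e a b. e \<in> carrier_vec n \<and> cinner e e = 1 \<and> conjugate (row Y 0) = a \<cdot>\<^sub>v e
    \<and> conjugate (row Z 0) = b \<cdot>\<^sub>v e"
  proof -
    obtain \<alpha> e where e: "\<alpha> \<ge> 0" "e \<in> carrier_vec n" "cinner e e = 1" and Ye: "conjugate (row Y 0) = of_real \<alpha> \<cdot>\<^sub>v e"
      by (rule unit_vector_decomposition[OF _ n, of "conjugate (row Y 0)"]) (use Y in auto)
    obtain \<beta> f where f: "\<beta> \<ge> 0" "f \<in> carrier_vec n" "cinner f f = 1" and Zf: "conjugate (row Z 0) = of_real \<beta> \<cdot>\<^sub>v f"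
      by (rule unit_vector_decomposition[OF _ n, of "conjugate (row Z 0)"]) (use Z in auto)
    have ed: "dim_vec e = n" "dim_vec f = n" using e f by auto
    \<comment> \<open>If one row is zero, the direction of the other one serves for both.\<close>
    consider "\<alpha> = 0" | "\<beta> = 0" | "\<alpha> > 0" "\<beta> > 0" using e f by linarith
    then show ?thesis
    proof cases
      case 1
      then have "conjugate (row Y 0) = 0 \<cdot>\<^sub>v f" unfolding Ye using ed by (intro eq_vecI) auto
      then show ?thesis using f Zf by blast
    next
      case 2
      then have "conjugate (row Z 0) = 0 \<cdot>\<^sub>v e" unfolding Zf using ed by (intro eq_vecI) auto
      then show ?thesis using e Ye by blast
    next
      case 3
      define R where "R = sqrt_mat U"
      have R: "positive_mat n R" "R * R = U" using sqrt_mat_square[OF U] by (simp_all add: R_def)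
      note RD = positive_matD[OF R(1)]
      have Rsum: "R = of_real \<alpha> \<cdot>\<^sub>m outer e + of_real \<beta> \<cdot>\<^sub>m outer f"
        using abs_mat_row[OF Y e(2,3) Ye] abs_mat_row[OF Z f(2,3) Zf] abs_sum 3 by (simp add: R_def)
      have "f = cinner e f \<cdot>\<^sub>v e"
      proof (rule unit_vectors_parallel[OF e(2,3) f(2,3)])
        fix v :: "complex vec" assume v: "v \<in> carrier_vec n"
        define s where "s = cinner e v"
        define t where "t = cinner f v"
        have Rv: "R *\<^sub>v v = (of_real \<alpha> * s) \<cdot>\<^sub>v e + (of_real \<beta> * t) \<cdot>\<^sub>v f"
          unfolding Rsum using v ed outer_carrier[OF e(2)] outer_carrier[OF f(2)]
          by (subst add_mult_distrib_mat_vec[of _ n n])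
            (auto simp: smult_mat_mult_vec outer_mult_vec smult_smult_assoc s_def t_def carrier_matD[OF outer_carrier[OF e(2)]]
              carrier_matD[OF outer_carrier[OF f(2)]])
        have "U *\<^sub>v v = R *\<^sub>v (R *\<^sub>v v)" using RD(1) v by (simp flip: R(2))
        then have "cinner v (U *\<^sub>v v) = cinner (R *\<^sub>v v) (R *\<^sub>v v)"
          using cinner_mult_right[OF RD(1) v mult_mat_vec_carrier[OF RD(1) v]] RD(2) by simp
        also have "\<dots> = of_real (\<alpha>\<^sup>2) * (cnj s * s) + of_real (\<beta>\<^sup>2) * (cnj t * t)
            + of_real (\<alpha> * \<beta>) * (cnj s * t * cinner e f + cnj (cnj s * t * cinner e f))"
          unfolding Rv using e f ed cinner_cnj[of e f]
          by (simp add: cinner_add_left cinner_add_right cinner_smult_left cinner_smult_right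
              power2_eq_square algebra_simps)
        finally have "Re (cinner v (U *\<^sub>v v)) = \<alpha>\<^sup>2 * Re (cnj s * s) + \<beta>\<^sup>2 * Re (cnj t * t)
            + 2 * \<alpha> * \<beta> * Re (cnj s * t * cinner e f)"
          by (simp del: times_complex.sel of_real_power of_real_mult complex_cnj_mult add: Re_of_real_mult)
        moreover have "Re (cnj s * s) = (cmod s)\<^sup>2" "Re (cnj t * t) = (cmod t)\<^sup>2"
          by (simp_all add: cmod_power2 flip: power2_eq_square)
        moreover have "cmod (cinner (conjugate (row Y 0)) v) = \<alpha> * cmod s"
          "cmod (cinner (conjugate (row Z 0)) v) = \<beta> * cmod t"
          unfolding Ye Zf using 3 by (simp_all add: cinner_smult_left norm_mult s_def t_def)
        \<comment> \<open>The squares on both sides agree, so only the mixed terms remain; division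
          by \<open>\<alpha> * \<beta>\<close> gives the hypothesis of
          \<open>unit_vectors_parallel\<close>.\<close>
        ultimately have "(\<alpha> * \<beta>) * (cmod s * cmod t) \<le> (\<alpha> * \<beta>) * Re (cnj s * t * cinner e f)"
          using ineq[OF v] by (simp add: power2_eq_square algebra_simps del: times_complex.sel)
        then show "cmod s * cmod t \<le> Re (cnj s * t * cinner e f)"
          using 3 by (simp del: times_complex.sel)
      qed
      then have "conjugate (row Z 0) = (of_real \<beta> * cinner e f) \<cdot>\<^sub>v e"
        unfolding Zf by (metis smult_smult_assoc)
      then show ?thesis using e Ye by blast
    qed
  qed
  then obtain e a b where e: "e \<in> carrier_vec n" "cinner e e = 1" and a: "conjugate (row Y 0) = a \<cdot>\<^sub>v e"
    and b: "conjugate (row Z 0) = b \<cdot>\<^sub>v e" by blast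
  \<comment> \<open>Along a common direction the absolute values add like numbers, and squaring
    recovers \<open>U\<close>.\<close>
  have "sqrt_mat U = of_real (cmod a + cmod b) \<cdot>\<^sub>m outer e"
    unfolding abs_sum[symmetric] abs_mat_row[OF Y e a] abs_mat_row[OF Z e b]
    by (simp add: add_smult_distrib_right_mat[OF outer_carrier[OF e(1)]])
  then have "U = of_real (cmod a + cmod b) * of_real (cmod a + cmod b) \<cdot>\<^sub>m outer e"
    using sqrt_mat_square(2)[OF U] outer_square[OF e] by metis
  then have "U = of_real ((cmod a + cmod b)\<^sup>2) \<cdot>\<^sub>m outer e"
    by (simp add: power2_eq_square)
  then show ?thesis using that[OF e a b] by blast
qed

section \<open>Block matrices and the normal form\<close>

lemma append_cols_dim [simp]:
  "dim_row (A @\<^sub>c B) = dim_row A" "dim_col (A @\<^sub>c B) = dim_col A + dim_col B"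
  by (simp_all add: append_cols_def)

lemma append_rows_dim [simp]:
  "dim_row (A @\<^sub>r B) = dim_row A + dim_row B" "dim_col (A @\<^sub>r B) = dim_col A"
  by (simp_all add: append_rows_def)

lemma append_cols_index_dim:
  "i < dim_row A \<Longrightarrow> j < dim_col A + dim_col B \<Longrightarrow>
    (A @\<^sub>c B) $$ (i, j) = (if j < dim_col A then A $$ (i, j) else B $$ (i, j - dim_col A))"
  by (simp add: append_cols_def)

lemma append_rows_index_dim:
  "i < dim_row A + dim_row B \<Longrightarrow> j < dim_col A \<Longrightarrow>
    (A @\<^sub>r B) $$ (i, j) = (if i < dim_row A then A $$ (i, j) else B $$ (i - dim_row A, j))"
  by (simp add: append_rows_def)

lemma scalar_mat_dim [simp]: "dim_row (scalar_mat c) = 1" "dim_col (scalar_mat c) = 1"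
  by (simp_all add: scalar_mat_def)

lemma scalar_mat_index [simp]: "i < 1 \<Longrightarrow> j < 1 \<Longrightarrow> scalar_mat c $$ (i, j) = c"
  by (simp add: scalar_mat_def)

text \<open>All blocks have the same size, so each is read off after a shift of the row or column
  index by \<open>k\<close>.\<close>

lemma four_block_mat_inject:
  assumes A: "A \<in> carrier_mat k k" "B \<in> carrier_mat k k" "C \<in> carrier_mat k k" "D \<in> carrier_mat k k"
    and A': "A' \<in> carrier_mat k k" "B' \<in> carrier_mat k k" "C' \<in> carrier_mat k k" "D' \<in> carrier_mat k k"
    and eq: "four_block_mat A B C D = four_block_mat A' B' C' D'"
  shows "A = A'" "B = B'" "C = C'" "D = D'"
proof -
  have e: "four_block_mat A B C D $$ (i, j) = four_block_mat A' B' C' D' $$ (i, j)" for i j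
    by (simp only: eq)
  note [simp] = carrier_matD[OF A(1)] carrier_matD[OF A(2)] carrier_matD[OF A(3)] carrier_matD[OF A(4)]
    carrier_matD[OF A'(1)] carrier_matD[OF A'(2)] carrier_matD[OF A'(3)] carrier_matD[OF A'(4)]
  show "A = A'"
  proof (rule eq_matI)
    fix i j assume "i < dim_row A'" "j < dim_col A'"
    then show "A $$ (i, j) = A' $$ (i, j)" using e[of i j] by simp
  qed auto
  show "B = B'"
  proof (rule eq_matI)
    fix i j assume "i < dim_row B'" "j < dim_col B'"
    then show "B $$ (i, j) = B' $$ (i, j)" using e[of i "j + k"] by simp
  qed auto
  show "C = C'"
  proof (rule eq_matI)
    fix i j assume "i < dim_row C'" "j < dim_col C'"
    then show "C $$ (i, j) = C' $$ (i, j)" using e[of "i + k" j] by simp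
  qed auto
  show "D = D'"
  proof (rule eq_matI)
    fix i j assume "i < dim_row D'" "j < dim_col D'"
    then show "D $$ (i, j) = D' $$ (i, j)" using e[of "i + k" "j + k"] by simp
  qed auto
qed

lemma positive_maps_conj:
  assumes \<phi>: "\<phi> \<in> positive_maps m k" and S: "S \<in> carrier_mat k k"
  shows "(\<lambda>A. mat_adjoint S * \<phi> A * S) \<in> positive_maps m k"
proof -
  note Sa = mat_adjoint_carrier[OF S]
  have lin: "\<And>A. A \<in> carrier_mat m m \<Longrightarrow> \<phi> A \<in> carrier_mat k k"
    "\<And>A B. A \<in> carrier_mat m m \<Longrightarrow> B \<in> carrier_mat m m \<Longrightarrow> \<phi> (A + B) = \<phi> A + \<phi> B"
    "\<And>c A. A \<in> carrier_mat m m \<Longrightarrow> \<phi> (c \<cdot>\<^sub>m A) = c \<cdot>\<^sub>m \<phi> A"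
    "\<And>A. positive_mat m A \<Longrightarrow> positive_mat k (\<phi> A)"
    using \<phi> by (auto simp: positive_maps_def linear_mat_map_def)
  show ?thesis unfolding positive_maps_def linear_mat_map_def
  proof (intro CollectI conjI ballI allI impI)
    fix A B :: "complex mat" assume A: "A \<in> carrier_mat m m" and B: "B \<in> carrier_mat m m"
    show "mat_adjoint S * \<phi> A * S \<in> carrier_mat k k"
      by (intro mult_carrier_mat[OF mult_carrier_mat[OF Sa lin(1)[OF A]] S])
    show "mat_adjoint S * \<phi> (A + B) * S = mat_adjoint S * \<phi> A * S + mat_adjoint S * \<phi> B * S"
      unfolding lin(2)[OF A B] mult_add_distrib_mat[OF Sa lin(1)[OF A] lin(1)[OF B]]
      by (rule add_mult_distrib_mat[OF mult_carrier_mat[OF Sa lin(1)[OF A]] mult_carrier_mat[OF Sa lin(1)[OF B]] S])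
  next
    fix c :: complex and A :: "complex mat" assume A: "A \<in> carrier_mat m m"
    show "mat_adjoint S * \<phi> (c \<cdot>\<^sub>m A) * S = c \<cdot>\<^sub>m (mat_adjoint S * \<phi> A * S)"
      unfolding lin(3)[OF A] mult_smult_distrib[OF Sa lin(1)[OF A]]
      by (rule mult_smult_assoc_mat[OF mult_carrier_mat[OF Sa lin(1)[OF A]] S])
  qed (auto intro: positive_mat_conj[OF lin(4) S])
qed

lemma unital_sum:
  assumes "\<phi> \<in> positive_maps 2 k" "unital_map 2 k \<phi>"
  shows "\<phi> (unit_mat2 0 0) + \<phi> (unit_mat2 1 1) = 1\<^sub>m k"
proof -
  have "unit_mat2 0 0 + unit_mat2 1 1 = 1\<^sub>m 2"
    by (rule eq_matI) (auto simp: unit_mat2_def less_2_cases_iff)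
  then show ?thesis using assms unit_mat2_carrier
    by (simp add: positive_maps_def linear_mat_map_def unital_map_def)
      (metis unit_mat2_carrier)
qed

text \<open>Translation of the display into usable forms: the diagonal blocks become direct sums,
  and the first row and column of \<phi>(E12) become functionals given by \<open>Y\<close> and
  \<open>Z\<close>. The conjugate in the last claim is due to \<open>mat_adjoint Z\<close> in the
  first column.\<close>

lemma choi_blocks:
  assumes \<phi>: "\<phi> \<in> positive_maps 2 (n + 1)"
    and B: "B \<in> carrier_mat n n" and U: "U \<in> carrier_mat n n" and T: "T \<in> carrier_mat n n"
    and Y: "Y \<in> carrier_mat 1 n" and Z: "Z \<in> carrier_mat 1 n"
    and choi: "choi_mat \<phi> =
      four_block_mat
        (1\<^sub>m 1 @\<^sub>c 0\<^sub>m 1 n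
         @\<^sub>r 0\<^sub>m n 1 @\<^sub>c B)
        (0\<^sub>m 1 1 @\<^sub>c Y
         @\<^sub>r mat_adjoint Z @\<^sub>c T)
        (0\<^sub>m 1 1 @\<^sub>c Z
         @\<^sub>r mat_adjoint Y @\<^sub>c mat_adjoint T)
        (0\<^sub>m 1 1 @\<^sub>c 0\<^sub>m 1 n
         @\<^sub>r 0\<^sub>m n 1 @\<^sub>c U)"
  shows "\<phi> (unit_mat2 0 0) = bordered_mat 1 B" "\<phi> (unit_mat2 1 1) = bordered_mat 0 U"
    "v \<in> carrier_vec n \<Longrightarrow> cinner (unit_vec (Suc n) 0) (\<phi> (unit_mat2 0 1) *\<^sub>v vCons 0 v)
      = cinner (conjugate (row Y 0)) v"
    "v \<in> carrier_vec n \<Longrightarrow> cinner (vCons 0 v) (\<phi> (unit_mat2 0 1) *\<^sub>v unit_vec (Suc n) 0)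
      = cnj (cinner (conjugate (row Z 0)) v)"
proof -
  note [simp] = carrier_matD[OF B] carrier_matD[OF U] carrier_matD[OF T] carrier_matD[OF Y] carrier_matD[OF Z]
  note h = positive_mapsD(1)[OF \<phi>]
  note blocks = four_block_mat_inject[OF h h h h _ _ _ _ choi[unfolded choi_mat_def]]
  have h00: "\<phi> (unit_mat2 0 0) = (1\<^sub>m 1 @\<^sub>c 0\<^sub>m 1 n @\<^sub>r 0\<^sub>m n 1 @\<^sub>c B)"
    and h01: "\<phi> (unit_mat2 0 1) = (0\<^sub>m 1 1 @\<^sub>c Y @\<^sub>r mat_adjoint Z @\<^sub>c T)"
    and h11: "\<phi> (unit_mat2 1 1) = (0\<^sub>m 1 1 @\<^sub>c 0\<^sub>m 1 n @\<^sub>r 0\<^sub>m n 1 @\<^sub>c U)"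
    by (rule blocks; rule carrier_matI; simp)+
  show "\<phi> (unit_mat2 0 0) = bordered_mat 1 B" unfolding h00
    by (rule eq_matI) (auto simp: append_rows_index_dim append_cols_index_dim bordered_mat_def)
  show "\<phi> (unit_mat2 1 1) = bordered_mat 0 U" unfolding h11
    by (rule eq_matI) (auto simp: append_rows_index_dim append_cols_index_dim bordered_mat_def)
  define K where "K = \<phi> (unit_mat2 0 1)"
  have Kd [simp]: "dim_row K = Suc n" "dim_col K = Suc n" by (simp_all add: K_def h01)
  have K0: "K $$ (0, Suc j) = Y $$ (0, j)" "K $$ (Suc j, 0) = cnj (Z $$ (0, j))" if "j < n" for j
    using that by (simp_all add: K_def h01 append_rows_index_dim append_cols_index_dim less_Suc_eq)
  fix v :: "complex vec" assume v: "v \<in> carrier_vec n"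
  have "cinner (unit_vec (Suc n) 0) (K *\<^sub>v vCons 0 v) = (\<Sum>j<Suc n. K $$ (0, j) * vCons 0 v $ j)"
    using v by (simp add: cinner_unit_left mult_vec_index_sum del: index_mult_mat_vec sum.lessThan_Suc)
  also have "\<dots> = cinner (conjugate (row Y 0)) v"
    unfolding cinner_conjugate_row[OF Y v] sum.lessThan_Suc_shift using v by (simp add: K0)
  finally show "cinner (unit_vec (Suc n) 0) (\<phi> (unit_mat2 0 1) *\<^sub>v vCons 0 v)
      = cinner (conjugate (row Y 0)) v" unfolding K_def .
  have "cinner (vCons 0 v) (K *\<^sub>v unit_vec (Suc n) 0) = (\<Sum>i<Suc n. cnj (vCons 0 v $ i) * K $$ (i, 0))"
    using v by (simp add: cinner_sum del: sum.lessThan_Suc)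
  also have "\<dots> = cnj (cinner (conjugate (row Z 0)) v)"
    unfolding cinner_conjugate_row[OF Z v] sum.lessThan_Suc_shift using v by (simp add: K0 mult.commute)
  finally show "cinner (vCons 0 v) (\<phi> (unit_mat2 0 1) *\<^sub>v unit_vec (Suc n) 0)
      = cnj (cinner (conjugate (row Z 0)) v)" unfolding K_def .
qed

lemma outer_unit_vec_index:
  "i < k \<Longrightarrow> j < k \<Longrightarrow> l < k \<Longrightarrow> outer (unit_vec k l) $$ (i, j) = (if i = l \<and> j = l then 1 else 0)"
  by (simp add: outer_def)

text \<open>Unitality determines \<phi>(E11) from \<phi>(E22). Vectors with last coordinate
  \<open>0\<close> lie in the kernel of \<phi>(E22), so \<phi>(E12) vanishes outside its last row
  and column. \<open>y\<close> and \<open>z\<close> are fixed in advance so that their moduli can be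
  computed from the original rows.\<close>

lemma normal_form:
  assumes n: "n \<ge> 2" and \<phi>: "\<phi> \<in> positive_maps 2 (n + 1)" and unital: "unital_map 2 (n + 1) \<phi>"
    and h11: "\<phi> (unit_mat2 1 1) = of_real u \<cdot>\<^sub>m outer (unit_vec (n + 1) n)"
    and y: "y = \<phi> (unit_mat2 0 1) $$ (0, n)" and z: "z = cnj (\<phi> (unit_mat2 0 1) $$ (n, 0))"
  obtains t V W where "V \<in> carrier_mat 1 (n - 1)" "W \<in> carrier_mat 1 (n - 1)"
    "choi_mat \<phi> =
         four_block_mat
           (1\<^sub>m 1 @\<^sub>c 0\<^sub>m 1 (n - 1) @\<^sub>c 0\<^sub>m 1 1
            @\<^sub>r 0\<^sub>m (n - 1) 1 @\<^sub>c 1\<^sub>m (n - 1) @\<^sub>c 0\<^sub>m (n - 1) 1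
            @\<^sub>r 0\<^sub>m 1 1 @\<^sub>c 0\<^sub>m 1 (n - 1) @\<^sub>c scalar_mat (1 - complex_of_real u))
           (0\<^sub>m 1 1 @\<^sub>c 0\<^sub>m 1 (n - 1) @\<^sub>c scalar_mat y
            @\<^sub>r 0\<^sub>m (n - 1) 1 @\<^sub>c 0\<^sub>m (n - 1) (n - 1) @\<^sub>c mat_adjoint W
            @\<^sub>r scalar_mat (cnj z) @\<^sub>c V @\<^sub>c scalar_mat t)
           (0\<^sub>m 1 1 @\<^sub>c 0\<^sub>m 1 (n - 1) @\<^sub>c scalar_mat z
            @\<^sub>r 0\<^sub>m (n - 1) 1 @\<^sub>c 0\<^sub>m (n - 1) (n - 1) @\<^sub>c mat_adjoint V
            @\<^sub>r scalar_mat (cnj y) @\<^sub>c W @\<^sub>c scalar_mat (cnj t))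
           (0\<^sub>m 1 1 @\<^sub>c 0\<^sub>m 1 (n - 1) @\<^sub>c 0\<^sub>m 1 1
            @\<^sub>r 0\<^sub>m (n - 1) 1 @\<^sub>c 0\<^sub>m (n - 1) (n - 1) @\<^sub>c 0\<^sub>m (n - 1) 1
            @\<^sub>r 0\<^sub>m 1 1 @\<^sub>c 0\<^sub>m 1 (n - 1) @\<^sub>c scalar_mat (complex_of_real u))"
    "\<And>\<rho>. \<rho> \<in> carrier_vec n \<Longrightarrow> cinner \<rho> \<rho> = 1 \<Longrightarrow>
       cmod (cinner \<rho> (col (mat_adjoint (scalar_mat (cnj y) @\<^sub>c W)) 0)) +
       cmod (cinner \<rho> (col (mat_adjoint (scalar_mat (cnj z) @\<^sub>c V)) 0)) \<le> sqrt u"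
proof -
  define K where "K = \<phi> (unit_mat2 0 1)"
  note h = positive_mapsD(1)[OF \<phi>]
  have K: "K \<in> carrier_mat (n + 1) (n + 1)" using h by (simp add: K_def)
  note Kd [simp] = carrier_matD[OF K]
  \<comment> \<open>Entry \<open>0\<close> of the last row and of the last column is kept for
    \<open>z\<close> and \<open>y\<close>, whence the shift \<open>j + 1\<close>. The column is
    conjugated because \<open>W\<close> enters this block through its adjoint.\<close>
  define V where "V = mat 1 (n - 1) (\<lambda>(i, j). K $$ (n, j + 1))"
  define W where "W = mat 1 (n - 1) (\<lambda>(i, j). cnj (K $$ (j + 1, n)))"
  have VW: "V \<in> carrier_mat 1 (n - 1)" "W \<in> carrier_mat 1 (n - 1)" by (simp_all add: V_def W_def)
  note VWd [simp] = carrier_matD[OF VW(1)] carrier_matD[OF VW(2)]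
  define E where "E = outer (unit_vec (n + 1) n)"
  have E: "E \<in> carrier_mat (n + 1) (n + 1)" by (simp add: E_def)
  note Ed [simp] = carrier_matD[OF E]
  have Ei: "E $$ (i, j) = (if i = n \<and> j = n then 1 else 0)" if "i < n + 1" "j < n + 1" for i j
    using that by (simp add: E_def outer_unit_vec_index)
  have Ev: "E *\<^sub>v v = v $ n \<cdot>\<^sub>v unit_vec (n + 1) n" if "v \<in> carrier_vec (n + 1)" for v
    using that by (simp add: E_def outer_mult_vec cinner_unit_left)
  have h00: "\<phi> (unit_mat2 0 0) = 1\<^sub>m (n + 1) - of_real u \<cdot>\<^sub>m E"
  proof (rule eq_matI)
    fix i j assume "i < dim_row (1\<^sub>m (n + 1) - of_real u \<cdot>\<^sub>m E)" "j < dim_col (1\<^sub>m (n + 1) - of_real u \<cdot>\<^sub>m E)"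
    then show "\<phi> (unit_mat2 0 0) $$ (i, j) = (1\<^sub>m (n + 1) - of_real u \<cdot>\<^sub>m E) $$ (i, j)"
      using arg_cong[OF unital_sum[OF \<phi> unital, unfolded h11 E_def[symmetric]], of "\<lambda>A. A $$ (i, j)"]
        carrier_matD[OF h]
      by (auto simp: algebra_simps)
  qed (use carrier_matD[OF h] in auto)
  have ker: "\<phi> (unit_mat2 1 1) *\<^sub>v v = 0\<^sub>v (n + 1)" if "v \<in> carrier_vec (n + 1)" "v $ n = 0" for v
    unfolding h11 E_def[symmetric] using that by (intro eq_vecI) (auto simp: smult_mat_mult_vec Ev)
  have K0: "K $$ (i, j) = 0" if ij: "i < n" "j < n" for i j
    using positive_maps_kernel_zero[OF \<phi> _ _ ker ker, of "unit_vec (n + 1) i" "unit_vec (n + 1) j"]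
      cinner_unit_mat[OF K, of i j] ij by (simp add: K_def)
  have adj: "\<phi> (unit_mat2 1 0) = mat_adjoint K"
    using positive_maps_adjoint[OF \<phi>] by (simp add: K_def)
  have yz: "y = K $$ (0, n)" "z = cnj (K $$ (n, 0))" using y z by (simp_all add: K_def)
  define t where "t = K $$ (n, n)"
  have H00: "\<phi> (unit_mat2 0 0) =
      (1\<^sub>m 1 @\<^sub>c 0\<^sub>m 1 (n - 1) @\<^sub>c 0\<^sub>m 1 1
            @\<^sub>r 0\<^sub>m (n - 1) 1 @\<^sub>c 1\<^sub>m (n - 1) @\<^sub>c 0\<^sub>m (n - 1) 1
            @\<^sub>r 0\<^sub>m 1 1 @\<^sub>c 0\<^sub>m 1 (n - 1) @\<^sub>c scalar_mat (1 - complex_of_real u))"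
    unfolding h00 using n
    by (intro eq_matI) (auto simp: append_rows_index_dim append_cols_index_dim Ei)
  have H01: "K =
      (0\<^sub>m 1 1 @\<^sub>c 0\<^sub>m 1 (n - 1) @\<^sub>c scalar_mat y
            @\<^sub>r 0\<^sub>m (n - 1) 1 @\<^sub>c 0\<^sub>m (n - 1) (n - 1) @\<^sub>c mat_adjoint W
            @\<^sub>r scalar_mat (cnj z) @\<^sub>c V @\<^sub>c scalar_mat t)" (is "K = ?M")
  proof (rule eq_matI)
    fix i j assume "i < dim_row ?M" "j < dim_col ?M"
    then have ij: "i < n + 1" "j < n + 1" using n by auto
    \<comment> \<open>The upper left square of size \<open>n\<close>, where \<open>K\<close>
      vanishes, and five pieces of the last row and column.\<close>
    then consider "i < n" "j < n" | "i = 0" "j = n" | "0 < i" "i < n" "j = n" | "i = n" "j = 0" 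
      | "i = n" "0 < j" "j < n" | "i = n" "j = n" by linarith
    then show "K $$ (i, j) = ?M $$ (i, j)"
      using n by cases
        (auto simp: append_rows_index_dim append_cols_index_dim K0 yz V_def W_def t_def)
  qed (use n in auto)
  have H10: "mat_adjoint K =
      (0\<^sub>m 1 1 @\<^sub>c 0\<^sub>m 1 (n - 1) @\<^sub>c scalar_mat z
            @\<^sub>r 0\<^sub>m (n - 1) 1 @\<^sub>c 0\<^sub>m (n - 1) (n - 1) @\<^sub>c mat_adjoint V
            @\<^sub>r scalar_mat (cnj y) @\<^sub>c W @\<^sub>c scalar_mat (cnj t))" (is "_ = ?M")
  proof (rule eq_matI)
    fix i j assume "i < dim_row ?M" "j < dim_col ?M"
    then have ij: "i < n + 1" "j < n + 1" using n by auto
    then consider "i < n" "j < n" | "i = 0" "j = n" | "0 < i" "i < n" "j = n" | "i = n" "j = 0" 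
      | "i = n" "0 < j" "j < n" | "i = n" "j = n" by linarith
    then show "mat_adjoint K $$ (i, j) = ?M $$ (i, j)"
      using n by cases
        (auto simp: append_rows_index_dim append_cols_index_dim K0 yz V_def W_def t_def)
  qed (use n in auto)
  have H11: "\<phi> (unit_mat2 1 1) =
      (0\<^sub>m 1 1 @\<^sub>c 0\<^sub>m 1 (n - 1) @\<^sub>c 0\<^sub>m 1 1
            @\<^sub>r 0\<^sub>m (n - 1) 1 @\<^sub>c 0\<^sub>m (n - 1) (n - 1) @\<^sub>c 0\<^sub>m (n - 1) 1
            @\<^sub>r 0\<^sub>m 1 1 @\<^sub>c 0\<^sub>m 1 (n - 1) @\<^sub>c scalar_mat (complex_of_real u))"
    unfolding h11 E_def[symmetric] using n
    by (intro eq_matI) (auto simp: append_rows_index_dim append_cols_index_dim Ei)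
  show ?thesis
  proof (rule that[OF VW])
    show "choi_mat \<phi> =
         four_block_mat
           (1\<^sub>m 1 @\<^sub>c 0\<^sub>m 1 (n - 1) @\<^sub>c 0\<^sub>m 1 1
            @\<^sub>r 0\<^sub>m (n - 1) 1 @\<^sub>c 1\<^sub>m (n - 1) @\<^sub>c 0\<^sub>m (n - 1) 1
            @\<^sub>r 0\<^sub>m 1 1 @\<^sub>c 0\<^sub>m 1 (n - 1) @\<^sub>c scalar_mat (1 - complex_of_real u))
           (0\<^sub>m 1 1 @\<^sub>c 0\<^sub>m 1 (n - 1) @\<^sub>c scalar_mat y
            @\<^sub>r 0\<^sub>m (n - 1) 1 @\<^sub>c 0\<^sub>m (n - 1) (n - 1) @\<^sub>c mat_adjoint W
            @\<^sub>r scalar_mat (cnj z) @\<^sub>c V @\<^sub>c scalar_mat t)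
           (0\<^sub>m 1 1 @\<^sub>c 0\<^sub>m 1 (n - 1) @\<^sub>c scalar_mat z
            @\<^sub>r 0\<^sub>m (n - 1) 1 @\<^sub>c 0\<^sub>m (n - 1) (n - 1) @\<^sub>c mat_adjoint V
            @\<^sub>r scalar_mat (cnj y) @\<^sub>c W @\<^sub>c scalar_mat (cnj t))
           (0\<^sub>m 1 1 @\<^sub>c 0\<^sub>m 1 (n - 1) @\<^sub>c 0\<^sub>m 1 1
            @\<^sub>r 0\<^sub>m (n - 1) 1 @\<^sub>c 0\<^sub>m (n - 1) (n - 1) @\<^sub>c 0\<^sub>m (n - 1) 1
            @\<^sub>r 0\<^sub>m 1 1 @\<^sub>c 0\<^sub>m 1 (n - 1) @\<^sub>c scalar_mat (complex_of_real u))"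
      unfolding choi_mat_def adj K_def[symmetric] H00[symmetric] H01[symmetric] H10[symmetric] H11[symmetric] ..
    fix \<rho> :: "complex vec" assume \<rho>: "\<rho> \<in> carrier_vec n" "cinner \<rho> \<rho> = 1"
    \<comment> \<open>The added last coordinate \<open>0\<close> puts \<open>x\<close> into the
      kernel of \<phi>(E22), and then \<phi>(E11) fixes it.\<close>
    define x where "x = vec (n + 1) (\<lambda>i. if i < n then \<rho> $ i else 0)"
    define e :: "complex vec" where "e = unit_vec (n + 1) n"
    have x: "x \<in> carrier_vec (n + 1)" "x $ n = 0" by (simp_all add: x_def)
    have e: "e \<in> carrier_vec (n + 1)" "e $ n = 1" by (simp_all add: e_def)
    have xx: "cinner x x = 1"
      using \<rho> by (simp add: cinner_sum x_def Suc_eq_plus1[symmetric])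
    have h00x: "\<phi> (unit_mat2 0 0) *\<^sub>v x = x"
      unfolding h00 using x by (subst minus_mult_distrib_mat_vec[of _ "n + 1" "n + 1"])
        (auto simp: smult_mat_mult_vec Ev intro!: eq_vecI)
    have h11e: "\<phi> (unit_mat2 1 1) *\<^sub>v e = of_real u \<cdot>\<^sub>v e"
      unfolding h11 E_def[symmetric] using e by (simp add: smult_mat_mult_vec Ev) (simp add: e_def)
    have "(cmod (cinner x (K *\<^sub>v e)) + cmod (cinner e (K *\<^sub>v x)))\<^sup>2 \<le> u"
      using positive_maps_kernel_inequality(1)[OF \<phi> x(1) e(1) ker[OF x]] xx e(1)
      unfolding h00x h11e K_def[symmetric]
      by (simp add: cinner_smult_right) (simp add: e_def cinner_unit_left)
    moreover have "cinner x (K *\<^sub>v e) = cinner \<rho> (col (mat_adjoint (scalar_mat (cnj y) @\<^sub>c W)) 0)"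
    proof -
      have "cinner x (K *\<^sub>v e) = (\<Sum>i<n. cnj (\<rho> $ i) * K $$ (i, n))"
        by (simp add: cinner_sum x_def e_def Suc_eq_plus1[symmetric])
      also have "\<dots> = cinner \<rho> (col (mat_adjoint (scalar_mat (cnj y) @\<^sub>c W)) 0)"
        using \<rho> n by (auto simp: cinner_sum append_cols_index_dim yz W_def intro!: sum.cong)
      finally show ?thesis .
    qed
    \<comment> \<open>This term is matched only up to conjugation, which does not affect the
      modulus.\<close>
    moreover have "cnj (cinner e (K *\<^sub>v x)) = cinner \<rho> (col (mat_adjoint (scalar_mat (cnj z) @\<^sub>c V)) 0)"
    proof -
      have "cinner e (K *\<^sub>v x) = (\<Sum>i<n. K $$ (n, i) * \<rho> $ i)"
        by (simp add: e_def cinner_unit_left mult_vec_index_sum x_def Suc_eq_plus1[symmetric]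
            del: index_mult_mat_vec)
      then have "cnj (cinner e (K *\<^sub>v x)) = (\<Sum>i<n. cnj (\<rho> $ i) * cnj (K $$ (n, i)))"
        by (simp add: mult.commute)
      also have "\<dots> = cinner \<rho> (col (mat_adjoint (scalar_mat (cnj z) @\<^sub>c V)) 0)"
        using \<rho> n by (auto simp: cinner_sum append_cols_index_dim yz V_def intro!: sum.cong)
      finally show ?thesis .
    qed
    ultimately show "cmod (cinner \<rho> (col (mat_adjoint (scalar_mat (cnj y) @\<^sub>c W)) 0)) +
       cmod (cinner \<rho> (col (mat_adjoint (scalar_mat (cnj z) @\<^sub>c V)) 0)) \<le> sqrt u"
      by (metis complex_mod_cnj real_le_rsqrt)
  qed
qed

section \<open>The theorem: common direction, change of basis and normal form\<close>

theorem theorem15: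
  fixes n :: nat and \<phi> :: "complex mat \<Rightarrow> complex mat"
    and B U T Y Z :: "complex mat"
  assumes n: "n \<ge> 2"
    and positive: "\<phi> \<in> positive_maps 2 (n + 1)"
    and unital: "unital_map 2 (n + 1) \<phi>"
    and B: "B \<in> carrier_mat n n" and U: "U \<in> carrier_mat n n" and T: "T \<in> carrier_mat n n"
    and Y: "Y \<in> carrier_mat 1 n" and Z: "Z \<in> carrier_mat 1 n"
    and B_pos: "positive_mat n B" and U_pos: "positive_mat n U"
    and choi: "choi_mat \<phi> =
      four_block_mat
        (1\<^sub>m 1 @\<^sub>c 0\<^sub>m 1 n
         @\<^sub>r 0\<^sub>m n 1 @\<^sub>c B)
        (0\<^sub>m 1 1 @\<^sub>c Y
         @\<^sub>r mat_adjoint Z @\<^sub>c T)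
        (0\<^sub>m 1 1 @\<^sub>c Z
         @\<^sub>r mat_adjoint Y @\<^sub>c mat_adjoint T)
        (0\<^sub>m 1 1 @\<^sub>c 0\<^sub>m 1 n
         @\<^sub>r 0\<^sub>m n 1 @\<^sub>c U)"
    and abs_sum: "abs_mat Y + abs_mat Z = sqrt_mat U"
  shows
    "(\<exists>\<xi> \<in> carrier_vec 2. \<exists>\<eta>\<^sub>0 \<in> carrier_vec (n + 1). \<xi> \<noteq> 0\<^sub>v 2 \<and>
       \<phi> \<in> (\<Inter>\<eta> \<in> {\<eta> \<in> carrier_vec (n + 1). cinner \<eta> \<eta>\<^sub>0 = 0}. face (n + 1) \<xi> \<eta>))
     \<and>
     (\<exists>\<phi>' (y::complex) (z::complex) (t::complex) (u::real) V W.
       V \<in> carrier_mat 1 (n - 1) \<and> W \<in> carrier_mat 1 (n - 1) \<and>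
       u = (cmod y + cmod z)\<^sup>2 \<and>
       unitarily_equivalent 2 (n + 1) \<phi> \<phi>' \<and>
       choi_mat \<phi>' =
         four_block_mat
           (1\<^sub>m 1 @\<^sub>c 0\<^sub>m 1 (n - 1) @\<^sub>c 0\<^sub>m 1 1
            @\<^sub>r 0\<^sub>m (n - 1) 1 @\<^sub>c 1\<^sub>m (n - 1) @\<^sub>c 0\<^sub>m (n - 1) 1
            @\<^sub>r 0\<^sub>m 1 1 @\<^sub>c 0\<^sub>m 1 (n - 1) @\<^sub>c scalar_mat (1 - complex_of_real u))
           (0\<^sub>m 1 1 @\<^sub>c 0\<^sub>m 1 (n - 1) @\<^sub>c scalar_mat y
            @\<^sub>r 0\<^sub>m (n - 1) 1 @\<^sub>c 0\<^sub>m (n - 1) (n - 1) @\<^sub>c mat_adjoint W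
            @\<^sub>r scalar_mat (cnj z) @\<^sub>c V @\<^sub>c scalar_mat t)
           (0\<^sub>m 1 1 @\<^sub>c 0\<^sub>m 1 (n - 1) @\<^sub>c scalar_mat z
            @\<^sub>r 0\<^sub>m (n - 1) 1 @\<^sub>c 0\<^sub>m (n - 1) (n - 1) @\<^sub>c mat_adjoint V
            @\<^sub>r scalar_mat (cnj y) @\<^sub>c W @\<^sub>c scalar_mat (cnj t))
           (0\<^sub>m 1 1 @\<^sub>c 0\<^sub>m 1 (n - 1) @\<^sub>c 0\<^sub>m 1 1
            @\<^sub>r 0\<^sub>m (n - 1) 1 @\<^sub>c 0\<^sub>m (n - 1) (n - 1) @\<^sub>c 0\<^sub>m (n - 1) 1
            @\<^sub>r 0\<^sub>m 1 1 @\<^sub>c 0\<^sub>m 1 (n - 1) @\<^sub>c scalar_mat (complex_of_real u)) \<and>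
       (let Y\<^sub>1 = scalar_mat (cnj y) @\<^sub>c W; Z\<^sub>1 = scalar_mat (cnj z) @\<^sub>c V in
         \<forall>\<rho> \<in> carrier_vec n. cinner \<rho> \<rho> = 1 \<longrightarrow>
           cmod (cinner \<rho> (col (mat_adjoint Y\<^sub>1) 0)) +
           cmod (cinner \<rho> (col (mat_adjoint Z\<^sub>1) 0)) \<le> sqrt u))"
proof -
  have k [simp]: "n + 1 = Suc n" by (rule Suc_eq_plus1[symmetric])
  have h: "\<phi> (unit_mat2 i j) \<in> carrier_mat (Suc n) (Suc n)" for i j
    using positive_mapsD(1)[OF positive, of i j] by (simp only: k)
  have positive': "\<phi> \<in> positive_maps 2 (Suc n)" using positive by simp
  note blocks = choi_blocks[OF positive B U T Y Z choi]
  have ineq: "(cmod (cinner (conjugate (row Y 0)) v) + cmod (cinner (conjugate (row Z 0)) v))\<^sup>2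
      \<le> Re (cinner v (U *\<^sub>v v))" if v: "v \<in> carrier_vec n" for v
  proof -
    \<comment> \<open>The first basis vector lies in the kernel of \<phi>(E22), and the form of
      \<phi>(E11) takes there the value \<open>1\<close> of the corner entry, so only
      \<open>cinner v (U v)\<close> remains on the right.\<close>
    define e0 :: "complex vec" where "e0 = unit_vec (Suc n) 0"
    have e0: "e0 = vCons 1 (0\<^sub>v n)"
      by (intro eq_vecI) (auto simp: e0_def less_Suc_eq_0_disj)
    have v': "vCons 0 v \<in> carrier_vec (Suc n)" "e0 \<in> carrier_vec (Suc n)" using v by (simp_all add: e0_def)
    have zero: "U *\<^sub>v 0\<^sub>v n = 0\<^sub>v n" using U by (intro eq_vecI) auto
    have "\<phi> (unit_mat2 1 1) *\<^sub>v e0 = 0\<^sub>v (Suc n)"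
      unfolding blocks(2) e0 using U zero by (simp add: bordered_mat_mult_vec zero_vec_Suc)
    from positive_maps_kernel_inequality(1)[OF positive' v'(2,1) this]
    show ?thesis
      unfolding e0 blocks(3,4)[OF v, folded e0_def, unfolded e0] blocks(1,2) using U B v
      by (simp add: bordered_mat_mult_vec cinner_vCons cinner_zero_left)
  qed
  obtain e a b where e: "e \<in> carrier_vec n" "cinner e e = 1" and a: "conjugate (row Y 0) = a \<cdot>\<^sub>v e"
    and b: "conjugate (row Z 0) = b \<cdot>\<^sub>v e" and Ue: "U = of_real ((cmod a + cmod b)\<^sup>2) \<cdot>\<^sub>m outer e"
    by (rule rows_common_direction[OF _ Y Z U_pos abs_sum ineq]) (use n in auto)
  define u where "u = (cmod a + cmod b)\<^sup>2"
  \<comment> \<open>With \<open>e\<close> placed in the last \<open>n\<close> coordinates,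
    \<phi>(E22) is \<open>u\<close> times the projection onto the line of \<open>\<eta>\<close>;
    this is the vector \<open>\<eta>\<^sub>0\<close> of the first claim.\<close>
  define \<eta> where "\<eta> = vCons 0 e"
  have \<eta>: "\<eta> \<in> carrier_vec (Suc n)" "cinner \<eta> \<eta> = 1" using e by (simp_all add: \<eta>_def cinner_vCons)
  have h11: "\<phi> (unit_mat2 1 1) = of_real u \<cdot>\<^sub>m outer \<eta>"
    unfolding blocks(2) Ue u_def[symmetric] \<eta>_def using e
    by (intro eq_matI) (auto simp: bordered_mat_def outer_def less_Suc_eq_0_disj)
  have h11v: "\<phi> (unit_mat2 1 1) *\<^sub>v v = (of_real u * cinner \<eta> v) \<cdot>\<^sub>v \<eta>" if "v \<in> carrier_vec (Suc n)" for v
    unfolding h11 using that \<eta> carrier_matD[OF outer_carrier[OF \<eta>(1)]]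
    by (simp add: smult_mat_mult_vec outer_mult_vec smult_smult_assoc)
  \<comment> \<open>The witness for \<open>\<xi>\<close> is the second basis vector, whose
    projection is \<open>unit_mat2 1 1\<close>.\<close>
  have part1: "\<phi> \<in> (\<Inter>\<eta>' \<in> {\<eta>' \<in> carrier_vec (n + 1). cinner \<eta>' \<eta> = 0}. face (n + 1) (vec2 0 1) \<eta>')"
  proof (intro INT_I)
    fix \<eta>' assume "\<eta>' \<in> {\<eta>' \<in> carrier_vec (n + 1). cinner \<eta>' \<eta> = 0}"
    then have \<eta>': "\<eta>' \<in> carrier_vec (Suc n)" "cinner \<eta>' \<eta> = 0" by simp_all
    then have "cinner \<eta> \<eta>' = 0" using cinner_cnj[of \<eta>' \<eta>] \<eta>(1) by simp
    then have "\<phi> (unit_mat2 1 1) *\<^sub>v \<eta>' = 0\<^sub>v (n + 1)"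
      using h11v[OF \<eta>'(1)] \<eta>(1) by (intro eq_vecI) (auto simp del: index_mult_mat_vec)
    moreover have "cinner (vec2 0 1) (vec2 0 1) = 1"
      by (simp add: cinner_sum numeral_2_eq_2)
    then have "proj_mat (vec2 0 1) = unit_mat2 1 1"
      unfolding unit_mat2_outer by (simp add: proj_mat_def outer_def)
    ultimately show "\<phi> \<in> face (n + 1) (vec2 0 1) \<eta>'"
      using positive by (simp add: face_def)
  qed
  obtain S c where S: "unitary_mat (Suc n) S" and c: "cmod c = 1" and Sn: "S *\<^sub>v unit_vec (Suc n) n = c \<cdot>\<^sub>v \<eta>"
    and Sfix: "\<And>v. v \<in> carrier_vec (Suc n) \<Longrightarrow> v $ n = 0 \<Longrightarrow> cinner \<eta> v = 0 \<Longrightarrow> S *\<^sub>v v = v"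
    by (rule unitary_to_unit_vector[OF _ \<eta>, of n]) auto
  \<comment> \<open>\<open>\<eta>\<close> starts with \<open>0\<close> and \<open>n\<close> is not
    \<open>0\<close>, so the first basis vector is orthogonal to \<open>\<eta>\<close> and to the
    last basis vector, and \<open>Sfix\<close> applies.\<close>
  have S0: "S *\<^sub>v unit_vec (Suc n) 0 = unit_vec (Suc n) 0"
    using n \<eta>(1) by (intro Sfix) (auto simp: cinner_unit_right \<eta>_def)
  have Sc: "S \<in> carrier_mat (Suc n) (Suc n)" using S by (simp add: unitary_mat_def)
  define \<phi>' where "\<phi>' A = mat_adjoint S * \<phi> A * S" for A
  have \<phi>'pos: "\<phi>' \<in> positive_maps 2 (n + 1)"
    using positive_maps_conj[OF positive' Sc] by (simp add: \<phi>'_def[abs_def])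
  have \<phi>'unital: "unital_map 2 (n + 1) \<phi>'"
    using unital unitary_mat_conj_one[OF S] by (simp add: unital_map_def \<phi>'_def)
  have entry: "\<phi>' (unit_mat2 i j) $$ (k, l)
      = cinner (S *\<^sub>v unit_vec (Suc n) k) (\<phi> (unit_mat2 i j) *\<^sub>v (S *\<^sub>v unit_vec (Suc n) l))"
    if "k < Suc n" "l < Suc n" for i j k l
    using cinner_conj[OF h Sc, of "unit_vec (Suc n) k" "unit_vec (Suc n) l" i j]
      cinner_unit_mat[OF positive_mapsD(1)[OF \<phi>'pos], of k l i j] that
    by (simp add: \<phi>'_def)
  define f :: "complex vec" where "f = unit_vec (Suc n) n"
  have f: "f \<in> carrier_vec (Suc n)" by (simp add: f_def)
  \<comment> \<open>The phase \<open>c\<close> drops out of \<open>outer\<close>, so \<phi>(E22) can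
    be expressed by the image under \<open>S\<close> of the last basis vector.\<close>
  have h11': "\<phi> (unit_mat2 1 1) = of_real u \<cdot>\<^sub>m outer (S *\<^sub>v f)"
    unfolding f_def Sn outer_smult c h11 by (intro eq_matI) simp_all
  have \<phi>'11: "\<phi>' (unit_mat2 1 1) = of_real u \<cdot>\<^sub>m outer (unit_vec (n + 1) n)"
  proof (rule eq_matI)
    fix k l assume "k < dim_row (of_real u \<cdot>\<^sub>m outer (unit_vec (n + 1) n))"
      "l < dim_col (of_real u \<cdot>\<^sub>m outer (unit_vec (n + 1) n))"
    then have kl: "k < Suc n" "l < Suc n" by (simp_all add: outer_def)
    have Sf: "S *\<^sub>v f \<in> carrier_vec (Suc n)" by (rule mult_mat_vec_carrier[OF Sc f])
    have Sl: "S *\<^sub>v unit_vec (Suc n) l \<in> carrier_vec (Suc n)" by (rule mult_mat_vec_carrier[OF Sc unit_vec_carrier])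
    have "\<phi> (unit_mat2 1 1) *\<^sub>v (S *\<^sub>v unit_vec (Suc n) l) =
        of_real u * cinner (S *\<^sub>v f) (S *\<^sub>v unit_vec (Suc n) l) \<cdot>\<^sub>v (S *\<^sub>v f)"
      unfolding h11' using Sf Sl carrier_matD[OF Sc] carrier_matD[OF outer_carrier[OF Sf]]
      by (simp add: smult_mat_mult_vec outer_mult_vec smult_smult_assoc)
    \<comment> \<open>\<open>S\<close> preserves scalar products, so in the end only the entry in
      position \<open>(n, n)\<close> survives.\<close>
    also have "cinner (S *\<^sub>v f) (S *\<^sub>v unit_vec (Suc n) l) = (if l = n then 1 else 0)"
      unfolding unitary_cinner[OF S f unit_vec_carrier] using kl by (auto simp: f_def cinner_unit_left)
    finally have "\<phi>' (unit_mat2 1 1) $$ (k, l) =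
      of_real u * (if l = n then 1 else 0) * cinner (S *\<^sub>v unit_vec (Suc n) k) (S *\<^sub>v f)"
      unfolding entry[OF kl] using Sc by (simp add: cinner_smult_right)
    also have "cinner (S *\<^sub>v unit_vec (Suc n) k) (S *\<^sub>v f) = (if k = n then 1 else 0)"
      unfolding unitary_cinner[OF S unit_vec_carrier f] using kl by (auto simp: f_def cinner_unit_left)
    finally show "\<phi>' (unit_mat2 1 1) $$ (k, l) = (of_real u \<cdot>\<^sub>m outer (unit_vec (n + 1) n)) $$ (k, l)"
      using kl carrier_matD[OF outer_carrier[OF unit_vec_carrier[of "n + 1" n]]] by (simp add: outer_unit_vec_index)
  qed (use carrier_matD[OF positive_mapsD(1)[OF \<phi>'pos]] in \<open>auto simp: outer_def\<close>)
  define y where "y = \<phi>' (unit_mat2 0 1) $$ (0, n)"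
  define z where "z = cnj (\<phi>' (unit_mat2 0 1) $$ (n, 0))"
  have ab: "cinner (conjugate (row Y 0)) e = cnj a" "cinner (conjugate (row Z 0)) e = cnj b"
    unfolding a b using e by (simp_all add: cinner_smult_left)
  \<comment> \<open>As \<open>S\<close> fixes the first basis vector, the corner entries of the new
    block are the functionals of \<open>Y\<close> and \<open>Z\<close> at \<open>c \<eta>\<close> up
    to conjugation. Since \<open>cmod c = 1\<close>, \<open>y\<close> and \<open>z\<close> have the
    moduli of \<open>a\<close> and \<open>b\<close>.\<close>
  have "y = c * cnj a"
    using mult_mat_vec[OF h \<eta>(1), of 0 1 c] blocks(3)[OF e(1)] ab carrier_matD[OF h]
    by (simp add: y_def entry S0 Sn cinner_smult_right \<eta>_def[symmetric])
  moreover have "z = c * cnj b"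
    using blocks(4)[OF e(1)] ab
    by (simp add: z_def entry S0 Sn cinner_smult_left \<eta>_def[symmetric])
  ultimately have u: "u = (cmod y + cmod z)\<^sup>2" using c by (simp add: u_def norm_mult)
  have equiv: "unitarily_equivalent 2 (n + 1) \<phi> \<phi>'"
    unfolding unitarily_equivalent_def \<phi>'_def using S by auto
  have "vec2 0 1 $ 1 \<noteq> 0\<^sub>v 2 $ 1" by simp
  then have "vec2 0 1 \<noteq> 0\<^sub>v 2" by metis
  then have part1': "\<exists>\<xi> \<in> carrier_vec 2. \<exists>\<eta>\<^sub>0 \<in> carrier_vec (n + 1). \<xi> \<noteq> 0\<^sub>v 2 \<and>
       \<phi> \<in> (\<Inter>\<eta> \<in> {\<eta> \<in> carrier_vec (n + 1). cinner \<eta> \<eta>\<^sub>0 = 0}. face (n + 1) \<xi> \<eta>)"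
    using part1 \<eta>(1) by (intro bexI[of _ "vec2 0 1"] bexI[of _ \<eta>]) auto
  show ?thesis
    apply (rule conjI[OF part1'])
    apply (rule normal_form[OF n \<phi>'pos \<phi>'unital \<phi>'11 y_def z_def])
    subgoal premises nf for V W t
      unfolding Let_def
      by (intro exI[of _ \<phi>'] exI[of _ y] exI[of _ z] exI[of _ t] exI[of _ u] exI[of _ V] exI[of _ W] conjI
          nf(1-3) u equiv ballI impI nf(4))
    done
qed

end
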